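(* Let $q\in(1,\infty)$ with $q\neq 2$ and let $d\geq 3$. Suppose $G$ is a connected finite simple graph with minimum degree $\delta(G)\leq d+1$ and maximum degree $\Delta(G)\leq d+2$. Then $G$ is independent in $\ell_q^d$ if and only if $G$ is $(d,d)$-sparse.
   Context: A graph $G$ is $(d,d)$-sparse if $d|V(H)|-|E(H)|\ge d$ for every subgraph $H$ of $G$ (with non-empty vertex set). $\ell_q^d$ denotes $\mathbb{R}^d$ with the norm $\|x\|_q=(\sum_{k=1}^d|x_k|^q)^{1/q}$. A placement of $G=(V,E)$ in $\ell_q^d$ is a point $p=(p_v)_{v\in V}\in(\mathbb{R}^d)^V$ with $p_v\ne p_w$ for every edge $vw\in E$. The (altered) rigidity matrix $\tilde R(G,p)$ has rows indexed by $E$ and columns indexed by $V\times\{1,\dots,d\}$; for an edge $e=vw$ and $1\le k\le d$, the $(e,(v,k))$ entry is $\operatorname{sgn}((p_v-p_w)_k)\,|(p_v-p_w)_k|^{q-1}$, the $(e,(w,k))$ entry is its negative, and all other entries in row $e$ are $0$. (The rigidity matrix $R(G,p)$ is obtained by dividing each row $vw$ by the positive scalar $\|p_v-p_w\|_q^{q-2}$, so it has the same rank.) The framework $(G,p)$ is independent if the rows of this matrix are linearly independent, and the graph $G$ is independent in $\ell_q^d$ if $(G,p)$ is independent for some placement $p$ in $\ell_q^d$. *)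

theory Defs
  imports "HOL-Analysis.Analysis"
begin

definition simple_graph :: "'v set \<Rightarrow> 'v set set \<Rightarrow> bool" where
  "simple_graph V E \<longleftrightarrow> (\<forall>e\<in>E. e \<subseteq> V \<and> card e = 2)"

definition finite_simple_graph :: "'v set \<Rightarrow> 'v set set \<Rightarrow> bool" where
  "finite_simple_graph V E \<longleftrightarrow> finite V \<and> simple_graph V E"

definition subgraph :: "'v set \<Rightarrow> 'v set set \<Rightarrow> 'v set \<Rightarrow> 'v set set \<Rightarrow> bool" where
  "subgraph V' E' V E \<longleftrightarrow> simple_graph V' E' \<and> V' \<subseteq> V \<and> E' \<subseteq> E"

text \<open>The graph without vertices is not regarded as connected.\<close>

definition connected_graph :: "'v set \<Rightarrow> 'v set set \<Rightarrow> bool" where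
  "connected_graph V E \<longleftrightarrow>
     V \<noteq> {} \<and> (\<forall>v\<in>V. \<forall>w\<in>V. (v, w) \<in> {(x, y). {x, y} \<in> E}\<^sup>*)"

definition vertex_degree :: "'v set set \<Rightarrow> 'v \<Rightarrow> nat" where
  "vertex_degree E v = card {e \<in> E. v \<in> e}"

definition min_degree :: "'v set \<Rightarrow> 'v set set \<Rightarrow> nat" where
  "min_degree V E = Min (vertex_degree E ` V)"

definition max_degree :: "'v set \<Rightarrow> 'v set set \<Rightarrow> nat" where
  "max_degree V E = Max (vertex_degree E ` V)"

definition dd_sparse :: "nat \<Rightarrow> 'v set \<Rightarrow> 'v set set \<Rightarrow> bool" where
  "dd_sparse d V E \<longleftrightarrow>
     (\<forall>V' E'. subgraph V' E' V E \<and> V' \<noteq> {} \<longrightarrow>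
        int d * int (card V') - int (card E') \<ge> int d)"

text \<open>
  The space of dimension \<open>d\<close> is \<open>real ^ 'd\<close> with \<open>d = CARD('d)\<close>. A placement is a function on the
  whole type \<open>'v\<close>, of which only the values on the vertex set matter.
\<close>

definition placement :: "'v set set \<Rightarrow> ('v \<Rightarrow> real ^ 'd) \<Rightarrow> bool" where
  "placement E p \<longleftrightarrow> (\<forall>v w. {v, w} \<in> E \<longrightarrow> p v \<noteq> p w)"

text \<open>
  The entry in row \<open>e = {v, w}\<close> and column \<open>(v, k)\<close> is
  \<open>sgn ((p v - p w) $ k) * \<bar>(p v - p w) $ k\<bar> powr (q - 1)\<close>. This expression is odd under exchanging
  \<open>v\<close> and \<open>w\<close>, so the same formula, read with the endpoints exchanged, gives the negated entry in
  column \<open>(w, k)\<close>, and no orientation of the edges is needed.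
\<close>

definition altered_rigidity_matrix ::
    "real \<Rightarrow> ('v \<Rightarrow> real ^ 'd) \<Rightarrow> 'v set \<Rightarrow> 'v \<times> 'd \<Rightarrow> real" where
  "altered_rigidity_matrix q p e = (\<lambda>(v, k).
     if v \<in> e
     then let w = (THE w. e = {v, w})
          in sgn ((p v - p w) $ k) * \<bar>(p v - p w) $ k\<bar> powr (q - 1)
     else 0)"

lemma altered_rigidity_matrix_endpoint1:
  "altered_rigidity_matrix q p {v, w} (v, k) =
     sgn ((p v - p w) $ k) * \<bar>(p v - p w) $ k\<bar> powr (q - 1)"
proof -
  have "(THE u. {v, w} = {v, u}) = w"
    by (rule the_equality) (auto simp: doubleton_eq_iff)
  then show ?thesis
    by (simp add: altered_rigidity_matrix_def Let_def)
qed

lemma altered_rigidity_matrix_endpoint2: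
  "altered_rigidity_matrix q p {v, w} (w, k) =
     - (sgn ((p v - p w) $ k) * \<bar>(p v - p w) $ k\<bar> powr (q - 1))"
proof -
  have "altered_rigidity_matrix q p {v, w} (w, k) =
      sgn ((p w - p v) $ k) * \<bar>(p w - p v) $ k\<bar> powr (q - 1)"
    using altered_rigidity_matrix_endpoint1[of q p w v k] by (simp add: insert_commute)
  also have "(p w - p v) $ k = - ((p v - p w) $ k)"
    by simp
  finally show ?thesis
    by (simp only: sgn_minus abs_minus_cancel mult_minus_left)
qed

lemma altered_rigidity_matrix_other:
  "v \<notin> e \<Longrightarrow> altered_rigidity_matrix q p e (v, k) = 0"
  by (simp add: altered_rigidity_matrix_def)

definition rows_lin_independent :: "'r set \<Rightarrow> 'c set \<Rightarrow> ('r \<Rightarrow> 'c \<Rightarrow> real) \<Rightarrow> bool" where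
  "rows_lin_independent R C M \<longleftrightarrow>
     (\<forall>a. (\<forall>j\<in>C. (\<Sum>i\<in>R. a i * M i j) = 0) \<longrightarrow> (\<forall>i\<in>R. a i = 0))"

definition independent_framework ::
    "real \<Rightarrow> 'v set \<Rightarrow> 'v set set \<Rightarrow> ('v \<Rightarrow> real ^ 'd) \<Rightarrow> bool" where
  "independent_framework q V E p \<longleftrightarrow>
     rows_lin_independent E (V \<times> UNIV) (altered_rigidity_matrix q p)"

text \<open>The argument of type \<open>'d itself\<close> fixes the dimension \<open>CARD('d)\<close>.\<close>

definition independent_graph :: "'d::finite itself \<Rightarrow> real \<Rightarrow> 'v set \<Rightarrow> 'v set set \<Rightarrow> bool" where
  "independent_graph (_ :: 'd itself) q V E \<longleftrightarrow>
     (\<exists>p :: 'v \<Rightarrow> real ^ 'd. placement E p \<and> independent_framework q V E p)"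

end

theory Submission
  imports Defs "HOL-Real_Asymp.Real_Asymp"
begin

text \<open>
  With maximum degree at most \<open>d + 2\<close> and \<open>d \<ge> 3\<close>, sparsity is automatic by counting edges, so
  everything lies in independence. By induction on the vertices, prove that a graph of maximum
  degree at most \<open>d + 2\<close> is independent if every nonempty vertex set contains a vertex with at most
  \<open>d + 1\<close> neighbours inside it; in the connected case this is the minimum degree condition.

  Remove a vertex \<open>v\<close> with at most \<open>d + 1\<close> neighbours. If it has at most \<open>d\<close>, a perturbation makes
  the rows at \<open>v\<close> independent in the columns of \<open>v\<close>. If it has \<open>d + 1\<close>, it suffices to find,
  throughout an open set of independent placements without \<open>v\<close>, an infinitesimal flex \<open>z\<close> that is not
  constant on the neighbours of \<open>v\<close>: if the coordinate \<open>z\<^sup>k\<close> is not constant, then sending the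
  \<open>k\<close>-th coordinate of \<open>v\<close> to infinity turns the determinant that has to be nonzero into one with
  columns \<open>1\<close>, \<open>z\<^sup>k\<close> and, for \<open>l \<noteq> k\<close>, the \<open>(q - 1)\<close>-th signed powers of the \<open>l\<close>-th
  coordinate differences. As \<open>q \<noteq> 2\<close>, the remaining coordinates of \<open>v\<close> can be chosen in \<open>{0, 1}\<close> so
  that it does not vanish.

  Such a flex exists if the neighbours of \<open>v\<close> are not all in one component of the graph without \<open>v\<close>
  (translate a component), or if two of them are not adjacent (add that edge and use induction), or
  if they form a clique (a dimension count).
\<close>

section \<open>Linear independence of finitely many rows\<close>

lemma rows_lin_independentD:
  "rows_lin_independent R C M \<Longrightarrow> (\<And>j. j \<in> C \<Longrightarrow> (\<Sum>i\<in>R. a i * M i j) = 0) \<Longrightarrow> i \<in> R \<Longrightarrow> a i = 0"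
  unfolding rows_lin_independent_def by blast

lemma rows_lin_independent_subset:
  assumes "rows_lin_independent R C M" "S \<subseteq> R" "finite R"
  shows "rows_lin_independent S C M"
  unfolding rows_lin_independent_def
proof (intro allI impI ballI)
  fix a i assume a: "\<forall>j\<in>C. (\<Sum>i\<in>S. a i * M i j) = 0" and i: "i \<in> S"
  have "(\<Sum>i\<in>R. (if i \<in> S then a i else 0) * M i j) = (\<Sum>i\<in>S. a i * M i j)" for j
    using assms(2,3) by (intro sum.mono_neutral_cong_right) auto
  then have "(if i \<in> S then a i else 0) = 0"
    using a i assms(2) by (intro rows_lin_independentD[OF assms(1), where a = "\<lambda>i. if i \<in> S then a i else 0"]) auto
  then show "a i = 0" using i by simp
qed

text \<open>Induction in the manner of Gram-Schmidt: a new row leaves a nonzero residue after its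
  components along the old rows are removed, and the entry of the residue at some column
  \<open>j0\<close> supplies the functional dual to the new row. Perturbation, solvability and some
  flexes are all read off from such a dual system.\<close>

lemma rows_lin_independent_dual:
  assumes "finite R" "finite C" "rows_lin_independent R C M"
  shows "\<exists>N. \<forall>i\<in>R. \<forall>i'\<in>R. (\<Sum>j\<in>C. M i j * N i' j) = (if i = i' then 1 else 0)"
  using assms(1,3)
proof (induction R rule: finite_induct)
  case empty
  then show ?case by simp
next
  case (insert r R)
  have "rows_lin_independent R C M"
    using rows_lin_independent_subset[OF insert.prems] insert.hyps by auto
  then obtain N where N: "\<And>i i'. i \<in> R \<Longrightarrow> i' \<in> R \<Longrightarrow> (\<Sum>j\<in>C. M i j * N i' j) = (if i = i' then 1 else 0)"
    using insert.IH by blast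
  define c where "c i = (\<Sum>j\<in>C. M r j * N i j)" for i
  define res where "res j = M r j - (\<Sum>i\<in>R. c i * M i j)" for j
  have "\<exists>j\<in>C. res j \<noteq> 0"
  proof (rule ccontr)
    assume zero: "\<not> ?thesis"
    have "(\<Sum>i\<in>insert r R. (if i = r then 1 else - c i) * M i j) = 0" if "j \<in> C" for j
    proof -
      have "(\<Sum>i\<in>R. (if i = r then 1 else - c i) * M i j) = (\<Sum>i\<in>R. - (c i * M i j))"
        using insert.hyps by (intro sum.cong) auto
      then show ?thesis
        using zero that insert.hyps by (simp add: res_def sum_negf)
    qed
    from rows_lin_independentD[OF insert.prems this, of r] show False by simp
  qed
  then obtain j0 where j0: "j0 \<in> C" "res j0 \<noteq> 0" by blast
  \<comment> \<open>Chosen so that pairing a vector with \<open>n\<close> gives the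
    \<open>j0\<close> entry of its residue, divided by \<open>res j0\<close>: this is 0 on the old
    rows and 1 on \<open>r\<close>.\<close>
  define n where "n j = ((if j = j0 then 1 else 0) - (\<Sum>i\<in>R. M i j0 * N i j)) / res j0" for j
  have pair: "(\<Sum>j\<in>C. m j * n j) = (m j0 - (\<Sum>i\<in>R. M i j0 * (\<Sum>j\<in>C. m j * N i j))) / res j0" for m
  proof -
    have "(\<Sum>j\<in>C. m j * n j) =
      (\<Sum>j\<in>C. m j * (if j = j0 then 1 else 0) - (\<Sum>i\<in>R. M i j0 * (m j * N i j))) / res j0"
      unfolding n_def sum_divide_distrib by (intro sum.cong) (simp_all add: algebra_simps sum_distrib_left)
    also have "\<dots> = ((\<Sum>j\<in>C. m j * (if j = j0 then 1 else 0)) - (\<Sum>i\<in>R. \<Sum>j\<in>C. M i j0 * (m j * N i j))) / res j0"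
      unfolding sum_subtractf by (subst sum.swap) simp
    finally show ?thesis using j0 assms(2)
      by (simp add: sum_distrib_left if_distrib[of "(*) _"] cong: if_cong)
  qed
  have nR: "(\<Sum>j\<in>C. M i j * n j) = 0" if "i \<in> R" for i
    using that insert.hyps(1) unfolding pair
    by (simp add: N if_distrib[of "(*) _"] cong: sum.cong if_cong)
  have nr: "(\<Sum>j\<in>C. M r j * n j) = 1"
    using j0 unfolding pair by (simp add: c_def[symmetric] res_def mult.commute)
  \<comment> \<open>Subtracting \<open>c i * n\<close> cancels the value \<open>c i\<close> that the
    old dual vector takes on the new row \<open>r\<close>.\<close>
  define N' where "N' i = (if i = r then n else (\<lambda>j. N i j - c i * n j))" for i
  have N'_pair: "(\<Sum>j\<in>C. m j * N' i j) = (\<Sum>j\<in>C. m j * N i j) - c i * (\<Sum>j\<in>C. m j * n j)" if "i \<noteq> r" for i m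
    using that by (simp add: N'_def algebra_simps sum_subtractf sum_distrib_left)
  have "(\<Sum>j\<in>C. M i j * N' i' j) = (if i = i' then 1 else 0)" if "i \<in> insert r R" "i' \<in> insert r R" for i i'
  proof (cases "i' = r")
    case True
    then show ?thesis using that nR nr insert.hyps by (auto simp: N'_def)
  next
    case False
    then have "i' \<in> R" using that by simp
    then show ?thesis using that N nR nr insert.hyps
      unfolding N'_pair[OF False] by (auto simp: c_def)
  qed
  then show ?case by blast
qed

text \<open>Paired with the dual system of the limit, \<open>X s\<close> is close to an identity
  matrix, and this excludes relations between its rows. An arbitrary filter covers both small
  perturbations of a placement and a vertex that tends to infinity.\<close>

lemma rows_lin_independent_eventually:
  assumes fin: "finite R" "finite C" and indep: "rows_lin_independent R C M"
    and lim: "\<And>i j. i \<in> R \<Longrightarrow> j \<in> C \<Longrightarrow> ((\<lambda>s. X s i j) \<longlongrightarrow> M i j) F"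
  shows "eventually (\<lambda>s. rows_lin_independent R C (X s)) F"
proof -
  obtain N where N: "\<And>i i'. i \<in> R \<Longrightarrow> i' \<in> R \<Longrightarrow> (\<Sum>j\<in>C. M i j * N i' j) = (if i = i' then 1 else 0)"
    using rows_lin_independent_dual[OF fin indep] by blast
  define P where "P s i i' = (\<Sum>j\<in>C. X s i j * N i' j)" for s i i'
  \<comment> \<open>Small enough for \<open>card R * \<epsilon> < 1\<close>; the added 1 also covers
    empty \<open>R\<close>.\<close>
  define \<epsilon> where "\<epsilon> = 1 / (real (card R) + 1)"
  have "\<epsilon> > 0" by (simp add: \<epsilon>_def)
  have "eventually (\<lambda>s. \<forall>i\<in>R. \<forall>i'\<in>R. dist (P s i i') (if i = i' then 1 else 0) < \<epsilon>) F"
  proof (intro eventually_ball_finite ballI fin)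
    fix i i' assume "i \<in> R" "i' \<in> R"
    then have "((\<lambda>s. P s i i') \<longlongrightarrow> (\<Sum>j\<in>C. M i j * N i' j)) F"
      unfolding P_def by (intro tendsto_intros lim)
    then show "eventually (\<lambda>s. dist (P s i i') (if i = i' then 1 else 0) < \<epsilon>) F"
      using N[OF \<open>i \<in> R\<close> \<open>i' \<in> R\<close>] \<open>\<epsilon> > 0\<close> by (simp add: tendsto_iff)
  qed
  then show ?thesis
  proof eventually_elim
    case (elim s)
    show ?case unfolding rows_lin_independent_def
    proof (intro allI impI)
      fix a assume a: "\<forall>j\<in>C. (\<Sum>i\<in>R. a i * X s i j) = 0"
      \<comment> \<open>Every coefficient will be bounded by \<open>\<epsilon> * S\<close>;
        summation then gives \<open>S \<le> card R * \<epsilon> * S\<close>, hence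
        \<open>S = 0\<close>.\<close>
      define S where "S = (\<Sum>i\<in>R. \<bar>a i\<bar>)"
      have "S \<ge> 0" by (simp add: S_def sum_nonneg)
      have bound: "\<bar>a i'\<bar> \<le> \<epsilon> * S" if i': "i' \<in> R" for i'
      proof -
        have "(\<Sum>i\<in>R. a i * P s i i') = (\<Sum>j\<in>C. (\<Sum>i\<in>R. a i * X s i j) * N i' j)"
          unfolding P_def sum_distrib_left sum_distrib_right
          by (subst sum.swap) (simp add: mult.assoc)
        also have "\<dots> = 0" using a by simp
        finally have "a i' = (\<Sum>i\<in>R. a i * ((if i = i' then 1 else 0) - P s i i'))"
          using fin(1) i' by (simp add: right_diff_distrib sum_subtractf if_distrib[of "(*) _"] cong: if_cong)
        also have "\<bar>\<dots>\<bar> \<le> (\<Sum>i\<in>R. \<bar>a i\<bar> * \<epsilon>)"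
          using elim i'
          unfolding dist_real_def abs_mult[symmetric]
          by (intro order.trans[OF sum_abs] sum_mono)
            (auto simp only: abs_mult abs_minus_commute intro!: mult_left_mono[OF less_imp_le] abs_ge_zero)
        finally show ?thesis by (simp add: S_def sum_distrib_left mult.commute)
      qed
      have "S \<le> (\<Sum>i\<in>R. \<epsilon> * S)" unfolding S_def using bound by (intro sum_mono) (simp add: S_def)
      then have "S \<le> (card R * \<epsilon>) * S" by simp
      moreover have "card R * \<epsilon> < 1" by (simp add: \<epsilon>_def)
      ultimately have "S = 0" using \<open>S \<ge> 0\<close> by (smt (verit) mult_less_cancel_right2)
      then show "\<forall>i\<in>R. a i = 0" using fin(1) by (simp add: S_def sum_nonneg_eq_0_iff)
    qed
  qed
qed

text \<open>Gaussian elimination: a nonzero entry of row \<open>r\<close> is the pivot, its unknown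
  is eliminated from the other equations and recovered from row \<open>r\<close> at the end.\<close>

lemma underdetermined_solution:
  fixes M :: "'r \<Rightarrow> 'c \<Rightarrow> real"
  assumes "finite R" "finite C" "card R < card C"
  shows "\<exists>z. (\<exists>j\<in>C. z j \<noteq> 0) \<and> (\<forall>i\<in>R. (\<Sum>j\<in>C. M i j * z j) = 0)"
  using assms
proof (induction R arbitrary: C M rule: finite_induct)
  case empty
  then obtain j where "j \<in> C" by fastforce
  then show ?case by (intro exI[of _ "\<lambda>_. 1"]) auto
next
  case (insert r R)
  show ?case
  proof (cases "\<forall>j\<in>C. M r j = 0")
    case True
    then show ?thesis using insert.IH[of C M] insert.prems insert.hyps by auto
  next
    case False
    then obtain j0 where j0: "j0 \<in> C" "M r j0 \<noteq> 0" by blast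
    let ?C = "C - {j0}"
    have "card R < card ?C" using insert.prems insert.hyps j0 by simp
    then obtain z where z: "\<exists>j\<in>?C. z j \<noteq> 0"
      "\<And>i. i \<in> R \<Longrightarrow> (\<Sum>j\<in>?C. (M i j - M i j0 * M r j / M r j0) * z j) = 0"
      using insert.IH[of ?C "\<lambda>i j. M i j - M i j0 * M r j / M r j0"] insert.prems by auto
    define s where "s = (\<Sum>j\<in>?C. M r j * z j) / M r j0"
    define z' where "z' = z(j0 := - s)"
    have eq: "(\<Sum>j\<in>C. M i j * z' j) = (\<Sum>j\<in>?C. M i j * z j) - M i j0 * s" for i
    proof -
      have "(\<Sum>j\<in>C. M i j * z' j) = M i j0 * z' j0 + (\<Sum>j\<in>?C. M i j * z' j)"
        using insert.prems j0 by (simp add: sum.remove)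
      then show ?thesis by (simp add: z'_def)
    qed
    have "(\<Sum>j\<in>C. M i j * z' j) = 0" if "i \<in> R" for i
      using z(2)[OF that] unfolding eq s_def
      by (simp add: left_diff_distrib sum_subtractf sum_distrib_left sum_divide_distrib mult.assoc)
    moreover have "(\<Sum>j\<in>C. M r j * z' j) = 0"
      unfolding eq s_def using j0 by simp
    moreover have "\<exists>j\<in>C. z' j \<noteq> 0" using z(1) by (auto simp: z'_def)
    ultimately show ?thesis by auto
  qed
qed

lemma sum_UNIV_option:
  fixes f :: "'a::finite option \<Rightarrow> 'b::comm_monoid_add"
  shows "(\<Sum>c\<in>UNIV. f c) = f None + (\<Sum>l\<in>UNIV. f (Some l))"
  by (simp add: UNIV_option_conv sum.reindex)

lemma rows_lin_independent_open:
  fixes X :: "'s::topological_space \<Rightarrow> 'r \<Rightarrow> 'c \<Rightarrow> real"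
  assumes "finite R" "finite C" "\<And>i j. i \<in> R \<Longrightarrow> j \<in> C \<Longrightarrow> continuous_on UNIV (\<lambda>s. X s i j)"
  shows "open {s. rows_lin_independent R C (X s)}"
proof (subst open_subopen, safe)
  fix s assume "rows_lin_independent R C (X s)"
  then have "eventually (\<lambda>s. rows_lin_independent R C (X s)) (nhds s)"
  proof (rule rows_lin_independent_eventually[OF assms(1,2)])
    fix i j assume "i \<in> R" "j \<in> C"
    then show "((\<lambda>s. X s i j) \<longlongrightarrow> X s i j) (nhds s)"
      using assms(3) unfolding tendsto_at_iff_tendsto_nhds[of "\<lambda>s. X s i j", symmetric]
      by (simp add: continuous_on_def)
  qed
  then show "\<exists>T. open T \<and> s \<in> T \<and> T \<subseteq> {s. rows_lin_independent R C (X s)}"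
    by (auto simp: eventually_nhds)
qed

lemma rows_lin_independent_solve:
  assumes "finite R" "finite C" "rows_lin_independent R C M"
  shows "\<exists>\<beta>. \<forall>i\<in>R. (\<Sum>j\<in>C. M i j * \<beta> j) = y i"
proof -
  obtain N where N: "\<And>i i'. i \<in> R \<Longrightarrow> i' \<in> R \<Longrightarrow> (\<Sum>j\<in>C. M i j * N i' j) = (if i = i' then 1 else 0)"
    using rows_lin_independent_dual[OF assms] by blast
  have "(\<Sum>j\<in>C. M i j * (\<Sum>i'\<in>R. y i' * N i' j)) = y i" if "i \<in> R" for i
  proof -
    have "(\<Sum>j\<in>C. M i j * (\<Sum>i'\<in>R. y i' * N i' j)) = (\<Sum>i'\<in>R. y i' * (\<Sum>j\<in>C. M i j * N i' j))"
      unfolding sum_distrib_left by (subst sum.swap) (simp add: mult_ac)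
    also have "\<dots> = (\<Sum>i'\<in>R. if i = i' then y i' else 0)"
      using N that by (intro sum.cong) auto
    finally show ?thesis using assms(1) that by simp
  qed
  then show ?thesis by (intro exI[of _ "\<lambda>j. \<Sum>i'\<in>R. y i' * N i' j"]) blast
qed

text \<open>If \<open>m\<close> were nonzero, adjoining it as an extra row (tagged
  \<open>None\<close>) would give more rows than columns, hence a nontrivial relation. Pairing this
  relation with \<open>m\<close> itself kills the rows of \<open>M\<close>, so the coefficient of
  \<open>m\<close> is zero and a relation between the rows of \<open>M\<close> remains.\<close>

lemma rows_lin_independent_kernel:
  assumes "finite R" "finite C" "rows_lin_independent R C M" "card C \<le> card R"
    and m: "\<And>i. i \<in> R \<Longrightarrow> (\<Sum>j\<in>C. M i j * m j) = 0" and "j \<in> C"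
  shows "m j = 0"
proof (rule ccontr)
  assume "m j \<noteq> 0"
  then have pos: "(\<Sum>j\<in>C. m j * m j) \<noteq> 0"
    using assms(2,6) by (subst sum_nonneg_eq_0_iff) auto
  define M' where "M' j c = (case c of None \<Rightarrow> m j | Some i \<Rightarrow> M i j)" for j c
  have "card C < card (insert None (Some ` R))"
    using assms(1,4) by (simp add: card_image)
  then obtain a where a: "\<exists>c\<in>insert None (Some ` R). a c \<noteq> 0"
    "\<And>j. j \<in> C \<Longrightarrow> (\<Sum>c\<in>insert None (Some ` R). M' j c * a c) = 0"
    using underdetermined_solution[of C "insert None (Some ` R)" M'] assms(1,2) by auto
  have a': "a None * m j + (\<Sum>i\<in>R. a (Some i) * M i j) = 0" if "j \<in> C" for j
    using a(2)[OF that] assms(1) by (simp add: sum.reindex M'_def mult.commute)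
  have "(\<Sum>j\<in>C. (a None * m j + (\<Sum>i\<in>R. a (Some i) * M i j)) * m j) =
      a None * (\<Sum>j\<in>C. m j * m j) + (\<Sum>i\<in>R. a (Some i) * (\<Sum>j\<in>C. M i j * m j))"
    unfolding distrib_right sum.distrib sum_distrib_left sum_distrib_right
    by (subst (2) sum.swap) (simp add: mult.assoc)
  then have "a None = 0" using a' m pos by simp
  moreover from this have "a (Some i) = 0" if "i \<in> R" for i
    using rows_lin_independentD[OF assms(3), of "\<lambda>i. a (Some i)" i] a' that by simp
  ultimately show False using a(1) by auto
qed

section \<open>Generic placements\<close>

text \<open>The finite case of Baire's theorem; it yields one placement that is generic for all
  pairs of coordinates at once.\<close>

lemma finite_dense_open_Int:
  fixes D :: "'a \<Rightarrow> 'b::topological_space set"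
  assumes "finite S" "open U" "U \<noteq> {}"
    and "\<And>c. c \<in> S \<Longrightarrow> open (D c)"
    and "\<And>c U. c \<in> S \<Longrightarrow> open U \<Longrightarrow> U \<noteq> {} \<Longrightarrow> U \<inter> D c \<noteq> {}"
  shows "U \<inter> (\<Inter>c\<in>S. D c) \<noteq> {} \<and> open (U \<inter> (\<Inter>c\<in>S. D c))"
  using assms(1,4,5)
proof (induction S rule: finite_induct)
  case empty
  then show ?case using assms by simp
next
  case (insert c S)
  then have IH: "U \<inter> (\<Inter>c\<in>S. D c) \<noteq> {}" "open (U \<inter> (\<Inter>c\<in>S. D c))" by auto
  have "U \<inter> (\<Inter>c\<in>insert c S. D c) = (U \<inter> (\<Inter>c\<in>S. D c)) \<inter> D c" by auto
  then show ?case using IH insert.prems by (simp add: open_Int)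
qed

text \<open>For finite \<open>C\<close> this says that the values of \<open>r\<close> on every
  nonempty open set span the whole space of vectors indexed by \<open>C\<close>.\<close>

definition locally_nondegenerate :: "('a::topological_space \<Rightarrow> 'c \<Rightarrow> real) \<Rightarrow> 'c set \<Rightarrow> bool" where
  "locally_nondegenerate r C \<longleftrightarrow>
     (\<forall>m U. open U \<longrightarrow> U \<noteq> {} \<longrightarrow> (\<forall>x\<in>U. (\<Sum>j\<in>C. r x j * m j) = 0) \<longrightarrow> (\<forall>j\<in>C. m j = 0))"

text \<open>The points are moved one at a time. As there are fewer earlier rows than columns, some
  \<open>m\<close> is orthogonal to all of them, and nondegeneracy moves the next row off the
  hyperplane orthogonal to \<open>m\<close>. Row \<open>w\<close> depends on the point of
  \<open>w\<close> alone, so the earlier rows stay as they are.\<close>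

lemma generic_rows_lin_independent:
  fixes p :: "'v \<Rightarrow> 'a::topological_space" and r :: "'v \<Rightarrow> 'a \<Rightarrow> 'c \<Rightarrow> real"
  assumes "finite I" "finite C" "card I \<le> card C"
    and nondeg: "\<And>w. w \<in> I \<Longrightarrow> locally_nondegenerate (r w) C"
    and "open U" "p \<in> U"
  shows "\<exists>p'\<in>U. (\<forall>u. u \<notin> I \<longrightarrow> p' u = p u) \<and> rows_lin_independent I C (\<lambda>w. r w (p' w))"
  using assms(1,3,4)
proof (induction I rule: finite_induct)
  case empty
  then show ?case using assms(6) by (auto simp: rows_lin_independent_def)
next
  case (insert w I)
  then obtain p' where p': "p' \<in> U" "\<And>u. u \<notin> I \<Longrightarrow> p' u = p u"
    "rows_lin_independent I C (\<lambda>w. r w (p' w))"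
    by auto
  obtain m where m: "\<exists>j\<in>C. m j \<noteq> 0" "\<And>i. i \<in> I \<Longrightarrow> (\<Sum>j\<in>C. r i (p' i) j * m j) = 0"
    using underdetermined_solution[of I C "\<lambda>w. r w (p' w)"] insert assms(2) by auto
  \<comment> \<open>The slice of \<open>U\<close> through \<open>p'\<close> in which only the point
    of \<open>w\<close> moves.\<close>
  define O' where "O' = (\<lambda>x. p'(w := x)) -` U"
  have "continuous_on UNIV (\<lambda>x. p'(w := x))"
  proof (intro continuous_on_coordinatewise_then_product)
    show "continuous_on UNIV (\<lambda>x. (p'(w := x)) i)" for i
      by (cases "i = w") auto
  qed
  then have "open O'" unfolding O'_def using assms(5) by (simp add: continuous_on_open_vimage)
  moreover have "p' w \<in> O'" using p'(1) by (simp add: O'_def)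
  ultimately obtain x where x: "x \<in> O'" "(\<Sum>j\<in>C. r w x j * m j) \<noteq> 0"
    using insert.prems(2)[of w] m(1) unfolding locally_nondegenerate_def by blast
  define q where "q = p'(w := x)"
  have qI: "q i = p' i" if "i \<in> I" for i using that insert.hyps by (auto simp: q_def)
  have "rows_lin_independent (insert w I) C (\<lambda>w. r w (q w))"
    unfolding rows_lin_independent_def
  proof (intro allI impI)
    fix a assume a: "\<forall>j\<in>C. (\<Sum>i\<in>insert w I. a i * r i (q i) j) = 0"
    have a': "a w * r w x j + (\<Sum>i\<in>I. a i * r i (p' i) j) = 0" if "j \<in> C" for j
    proof -
      have "(\<Sum>i\<in>insert w I. a i * r i (q i) j) = a w * r w x j + (\<Sum>i\<in>I. a i * r i (q i) j)"
        using insert.hyps by (simp add: q_def)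
      then show ?thesis using a that qI by simp
    qed
    have "(\<Sum>j\<in>C. (a w * r w x j + (\<Sum>i\<in>I. a i * r i (p' i) j)) * m j) =
      a w * (\<Sum>j\<in>C. r w x j * m j) + (\<Sum>i\<in>I. a i * (\<Sum>j\<in>C. r i (p' i) j * m j))"
      unfolding distrib_right sum.distrib sum_distrib_left sum_distrib_right
      by (subst (2) sum.swap) (simp add: mult.assoc)
    then have "a w * (\<Sum>j\<in>C. r w x j * m j) = 0" using a' m(2) by simp
    then have aw: "a w = 0" using x by simp
    then have "(\<Sum>i\<in>I. a i * r i (p' i) j) = 0" if "j \<in> C" for j using a'[OF that] by simp
    from rows_lin_independentD[OF p'(3) this] aw show "\<forall>i\<in>insert w I. a i = 0" by auto
  qed
  moreover have "q \<in> U" using x by (simp add: q_def O'_def)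
  moreover have "\<forall>u. u \<notin> insert w I \<longrightarrow> q u = p u" using p'(2) by (simp add: q_def)
  ultimately show ?case by blast
qed

section \<open>The signed power\<close>

text \<open>With \<open>r = q - 1\<close> this odd function gives the entries of the rigidity
  matrix.\<close>

definition spow :: "real \<Rightarrow> real \<Rightarrow> real" where
  "spow r t = sgn t * \<bar>t\<bar> powr r"

lemma spow_0 [simp]: "spow r 0 = 0"
  by (simp add: spow_def)

lemma spow_minus [simp]: "spow r (- t) = - spow r t"
  by (simp add: spow_def sgn_minus)

lemma spow_strict_mono:
  assumes "r > 0" "x < y"
  shows "spow r x < spow r y"
proof -
  consider "0 \<le> x" | "x < 0" "0 \<le> y" | "y < 0" by linarith
  then show ?thesis
  proof cases
    case 1
    then have "\<bar>x\<bar> powr r < \<bar>y\<bar> powr r" using assms by (intro powr_less_mono2) auto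
    then show ?thesis using 1 assms by (cases "x = 0") (auto simp: spow_def)
  next
    case 2
    then have "spow r x < 0" "spow r y \<ge> 0" by (auto simp: spow_def)
    then show ?thesis by linarith
  next
    case 3
    then have "\<bar>y\<bar> powr r < \<bar>x\<bar> powr r" using assms by (intro powr_less_mono2) auto
    then show ?thesis using 3 assms by (auto simp: spow_def)
  qed
qed

lemma spow_eq_iff: "r > 0 \<Longrightarrow> spow r x = spow r y \<longleftrightarrow> x = y"
  by (metis less_irrefl linorder_neqE_linordered_idom spow_strict_mono)

lemma continuous_on_spow:
  assumes "r > 0"
  shows "continuous_on S (spow r)"
proof -
  \<comment> \<open>Positive part minus negative part: this form is visibly continuous at 0, where
    \<open>sgn\<close> jumps.\<close>
  have "spow r = (\<lambda>t. max t 0 powr r - max (- t) 0 powr r)"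
    by (auto simp: fun_eq_iff spow_def sgn_if max_def)
  then show ?thesis using assms
    by (auto intro!: continuous_intros continuous_on_powr')
qed

lemma spow_shift_asymp: "((\<lambda>T. spow r (T - a) / T powr r) \<longlongrightarrow> 1) at_top"
proof -
  have "((\<lambda>T. ((T - a) / T) powr r) \<longlongrightarrow> 1 powr r) at_top"
    by (intro tendsto_intros) (real_asymp | simp)+
  moreover have "eventually (\<lambda>T. ((T - a) / T) powr r = spow r (T - a) / T powr r) at_top"
    using eventually_gt_at_top[of "max 0 a"]
    by eventually_elim (simp add: spow_def powr_divide)
  ultimately show ?thesis by (auto intro: Lim_transform_eventually)
qed

lemma DERIV_spow:
  assumes "t \<noteq> 0"
  shows "(spow r has_real_derivative r * \<bar>t\<bar> powr (r - 1)) (at t)"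
proof (cases "t > 0")
  case True
  have "((\<lambda>t. t powr r) has_real_derivative r * t powr (r - 1)) (at t)"
    using True by (rule has_real_derivative_powr)
  moreover have "eventually (\<lambda>t. t powr r = spow r t) (nhds t)"
    using eventually_nhds_in_open[of "{0<..}" t] True by (auto elim!: eventually_mono simp: spow_def)
  ultimately show ?thesis using True by (simp add: DERIV_cong_ev)
next
  case False
  then have "t < 0" using assms by simp
  have "((\<lambda>t. - ((- t) powr r)) has_real_derivative r * (- t) powr (r - 1)) (at t)"
    using \<open>t < 0\<close> by (auto intro!: derivative_eq_intros)
  moreover have "eventually (\<lambda>t. - ((- t) powr r) = spow r t) (nhds t)"
    using eventually_nhds_in_open[of "{..<0}" t] \<open>t < 0\<close> by (auto elim!: eventually_mono simp: spow_def)
  ultimately show ?thesis using \<open>t < 0\<close> by (simp add: DERIV_cong_ev)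
qed

text \<open>The derivatives of the two powers are proportional only where \<open>\<bar>x\<bar> / \<bar>1 - x\<bar>\<close> is constant.
  This is the only place where \<open>q = r + 1 \<noteq> 2\<close> is used.\<close>

lemma spow_reflected_independent:
  assumes "r > 0" "r \<noteq> 1" and U: "open U" "U \<noteq> {}"
    and eq: "\<And>x. x \<in> U \<Longrightarrow> c + \<alpha> * spow r x + \<beta> * spow r (1 - x) = 0"
  shows "\<alpha> = 0 \<and> \<beta> = 0"
proof -
  \<comment> \<open>The points where \<open>spow r x\<close> or \<open>spow r (1 - x)\<close> may
    fail to be differentiable are removed.\<close>
  define U' where "U' = U - {0, 1}"
  have "open U'" unfolding U'_def using U by (intro open_Diff finite_imp_closed) auto
  have inf: "infinite U'"
    unfolding U'_def using U finite_imp_not_open[of U] by (intro Diff_infinite_finite) auto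
  have proportional: "\<alpha> * \<bar>x\<bar> powr (r - 1) = \<beta> * \<bar>1 - x\<bar> powr (r - 1)" if "x \<in> U'" for x
  proof -
    have x: "x \<noteq> 0" "1 - x \<noteq> 0" using that by (auto simp: U'_def)
    have "((\<lambda>x. c + \<alpha> * spow r x + \<beta> * spow r (1 - x)) has_real_derivative
        \<alpha> * (r * \<bar>x\<bar> powr (r - 1)) - \<beta> * (r * \<bar>1 - x\<bar> powr (r - 1))) (at x)"
      by (rule derivative_eq_intros DERIV_spow[OF x(1)] refl
          DERIV_chain2[where f = "spow r" and g = "\<lambda>x. 1 - x", OF DERIV_spow[OF x(2)]])+ simp
    moreover have "((\<lambda>x. c + \<alpha> * spow r x + \<beta> * spow r (1 - x)) has_real_derivative 0) (at x)"
    proof (subst DERIV_cong_ev)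
      show "eventually (\<lambda>x. c + \<alpha> * spow r x + \<beta> * spow r (1 - x) = 0) (nhds x)"
        using eventually_nhds_in_open[OF \<open>open U'\<close> that] eq by (auto elim!: eventually_mono simp: U'_def)
    qed auto
    ultimately have "\<alpha> * (r * \<bar>x\<bar> powr (r - 1)) - \<beta> * (r * \<bar>1 - x\<bar> powr (r - 1)) = 0"
      by (rule DERIV_unique)
    then have "r * (\<alpha> * \<bar>x\<bar> powr (r - 1) - \<beta> * \<bar>1 - x\<bar> powr (r - 1)) = 0"
      by (simp add: algebra_simps)
    then show ?thesis using assms(1) by simp
  qed
  have zero_iff: "\<alpha> = 0 \<longleftrightarrow> \<beta> = 0"
  proof -
    obtain x where "x \<in> U'" using inf by fastforce
    then show ?thesis using proportional[of x] by (auto simp: U'_def)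
  qed
  show ?thesis
  proof (rule ccontr)
    assume "\<not> ?thesis"
    then have nz: "\<alpha> \<noteq> 0" "\<beta> \<noteq> 0" using zero_iff by auto
    \<comment> \<open>The value forced on \<open>\<bar>x\<bar> / \<bar>1 - x\<bar>\<close> by the
      proportionality; solving for it takes the root of order \<open>r - 1\<close>, which is
      nonzero.\<close>
    define k where "k = (\<beta> / \<alpha>) powr (1 / (r - 1))"
    have "\<bar>x\<bar> = k * \<bar>1 - x\<bar>" if "x \<in> U'" for x
    proof -
      have x: "\<bar>x\<bar> > 0" "\<bar>1 - x\<bar> > 0" using that by (auto simp: U'_def)
      have "(\<bar>x\<bar> / \<bar>1 - x\<bar>) powr (r - 1) = \<beta> / \<alpha>"
        using proportional[OF that] nz x by (simp add: powr_divide field_simps)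
      then have "k = ((\<bar>x\<bar> / \<bar>1 - x\<bar>) powr (r - 1)) powr (1 / (r - 1))"
        by (simp add: k_def)
      also have "\<dots> = \<bar>x\<bar> / \<bar>1 - x\<bar>"
        using assms(2) x by (simp only: powr_powr) simp
      finally have "k = \<bar>x\<bar> / \<bar>1 - x\<bar>" .
      then show ?thesis using x by simp
    qed
    then have "U' \<subseteq> {x. x = k * (1 - x)} \<union> {x. x = - k * (1 - x)}"
      by (fastforce simp: abs_if split: if_splits)
    moreover have "finite {x::real. x = l * (1 - x)}" for l
    proof (rule finite_subset)
      \<comment> \<open>For \<open>l = - 1\<close> the equation reads \<open>x = x - 1\<close> and
        has no solution, so the default value of the division by zero is harmless.\<close>
      show "{x. x = l * (1 - x)} \<subseteq> {l / (1 + l)}"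
        by (cases "l = - 1") (auto simp: field_simps)
    qed simp
    ultimately show False using inf finite_subset finite_UnI by meson
  qed
qed

section \<open>Rigidity matrices\<close>

definition neighbours :: "'v set set \<Rightarrow> 'v \<Rightarrow> 'v set" where
  "neighbours E v = {w. {v, w} \<in> E}"

definition del_vertex :: "'v set set \<Rightarrow> 'v \<Rightarrow> 'v set set" where
  "del_vertex E v = {e \<in> E. v \<notin> e}"

section \<open>Edges and neighbourhoods in finite simple graphs\<close>

lemma simple_graph_edge:
  assumes "simple_graph V E" "e \<in> E"
  obtains a b where "e = {a, b}" "a \<noteq> b" "a \<in> V" "b \<in> V"
proof -
  have "e \<subseteq> V" "card e = 2" using assms by (auto simp: simple_graph_def)
  then obtain a b where "e = {a, b}" "a \<noteq> b" by (meson card_2_iff)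
  then show ?thesis using \<open>e \<subseteq> V\<close> that by blast
qed

lemma simple_graph_doubleton:
  assumes "simple_graph V E" "{a, b} \<in> E"
  shows "a \<noteq> b \<and> a \<in> V \<and> b \<in> V"
proof -
  have "{a, b} \<subseteq> V" "card {a, b} = 2" using assms by (auto simp only: simple_graph_def)
  then show ?thesis by (cases "a = b") auto
qed

lemma finite_simple_graph_edges:
  assumes "finite_simple_graph V E"
  shows "finite E"
proof (rule finite_subset)
  show "E \<subseteq> Pow V" using assms by (auto simp: finite_simple_graph_def simple_graph_def)
  show "finite (Pow V)" using assms by (simp add: finite_simple_graph_def)
qed

lemma neighbours_subset: "simple_graph V E \<Longrightarrow> neighbours E v \<subseteq> V - {v}"
  unfolding neighbours_def using simple_graph_doubleton by fast

lemma finite_neighbours: "finite_simple_graph V E \<Longrightarrow> finite (neighbours E v)"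
  unfolding finite_simple_graph_def by (meson finite_Diff finite_subset neighbours_subset)

lemma finite_simple_graph_del_vertex:
  "finite_simple_graph V E \<Longrightarrow> finite_simple_graph (V - {v}) (del_vertex E v)"
  by (auto simp: finite_simple_graph_def simple_graph_def del_vertex_def)

lemma edges_at_eq_image:
  assumes "simple_graph V E"
  shows "{e \<in> E. v \<in> e} = (\<lambda>w. {v, w}) ` neighbours E v"
proof -
  have "e \<in> (\<lambda>w. {v, w}) ` neighbours E v" if e: "e \<in> E" "v \<in> e" for e
  proof -
    obtain a b where "e = {a, b}" using simple_graph_edge[OF assms e(1)] .
    then show ?thesis using e by (auto simp: neighbours_def insert_commute)
  qed
  then show ?thesis by (auto simp: neighbours_def)
qed

lemma inj_on_edge: "inj_on (\<lambda>w. {v, w}) A"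
  by (auto simp: inj_on_def doubleton_eq_iff)

lemma vertex_degree_eq_card_neighbours:
  "simple_graph V E \<Longrightarrow> vertex_degree E v = card (neighbours E v)"
  unfolding vertex_degree_def by (simp add: edges_at_eq_image card_image inj_on_edge)

lemma sum_edges_split:
  fixes f :: "'v set \<Rightarrow> real"
  assumes "finite_simple_graph V E"
  shows "(\<Sum>e\<in>E. f e) = (\<Sum>e\<in>del_vertex E v. f e) + (\<Sum>w\<in>neighbours E v. f {v, w})"
proof -
  have "E = del_vertex E v \<union> {e \<in> E. v \<in> e}" "del_vertex E v \<inter> {e \<in> E. v \<in> e} = {}"
    by (auto simp: del_vertex_def)
  then have "(\<Sum>e\<in>E. f e) = (\<Sum>e\<in>del_vertex E v. f e) + (\<Sum>e\<in>{e \<in> E. v \<in> e}. f e)"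
    using finite_simple_graph_edges[OF assms] by (metis (no_types, lifting) finite_Un sum.union_disjoint)
  also have "{e \<in> E. v \<in> e} = (\<lambda>w. {v, w}) ` neighbours E v"
    using assms by (intro edges_at_eq_image) (auto simp: finite_simple_graph_def)
  finally show ?thesis
    by (simp add: sum.reindex inj_on_edge)
qed

section \<open>Rows of the rigidity matrix, their pairing with velocities, and the addition of a
  vertex\<close>

lemma altered_rigidity_matrix_edge:
  fixes p :: "'v \<Rightarrow> real ^ 'd"
  assumes "a \<noteq> b"
  shows "altered_rigidity_matrix q p {a, b} (u, k) =
    spow (q - 1) ((p a - p b) $ k) * (of_bool (u = a) - of_bool (u = b))"
proof -
  consider "u = a" | "u = b" | "u \<notin> {a, b}" by blast
  then show ?thesis
  proof cases
    case 1
    then show ?thesis using assms by (simp add: altered_rigidity_matrix_endpoint1 spow_def)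
  next
    case 2
    then show ?thesis using assms by (simp add: altered_rigidity_matrix_endpoint2 spow_def)
  next
    case 3
    then show ?thesis by (simp add: altered_rigidity_matrix_other)
  qed
qed

text \<open>Here \<open>z\<close> is a velocity field. An endpoint outside \<open>V\<close> counts
  as fixed, so that the formula also applies to edges at a deleted vertex.\<close>

lemma rigidity_row_pairing:
  fixes p :: "'v \<Rightarrow> real ^ 'd"
  assumes "finite V" "a \<noteq> b"
  shows "(\<Sum>j\<in>V \<times> UNIV. altered_rigidity_matrix q p {a, b} j * z j) =
    (\<Sum>k\<in>UNIV. spow (q - 1) ((p a - p b) $ k) *
      ((if a \<in> V then z (a, k) else 0) - (if b \<in> V then z (b, k) else 0)))"
proof -
  have "(\<Sum>j\<in>V \<times> UNIV. altered_rigidity_matrix q p {a, b} j * z j) =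
    (\<Sum>k\<in>UNIV. \<Sum>u\<in>V. altered_rigidity_matrix q p {a, b} (u, k) * z (u, k))"
    by (subst sum.swap) (simp add: sum.cartesian_product split_beta)
  also have "\<dots> = (\<Sum>k\<in>UNIV. spow (q - 1) ((p a - p b) $ k) *
      (\<Sum>u\<in>V. (if u = a then z (u, k) else 0) - (if u = b then z (u, k) else 0)))"
    unfolding sum_distrib_left
    by (intro sum.cong) (auto simp: altered_rigidity_matrix_edge[OF assms(2)])
  finally show ?thesis using assms(1) by (simp add: sum_subtractf)
qed

lemma independent_framework_subset:
  "independent_framework q V E p \<Longrightarrow> E' \<subseteq> E \<Longrightarrow> finite E \<Longrightarrow> independent_framework q V E' p"
  unfolding independent_framework_def by (rule rows_lin_independent_subset)

lemma independent_framework_open: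
  assumes "finite_simple_graph V E" "q > 1"
  shows "open {p :: 'v \<Rightarrow> real ^ 'd. independent_framework q V E p}"
  unfolding independent_framework_def
proof (rule rows_lin_independent_open)
  show "finite E" "finite (V \<times> (UNIV :: 'd set))"
    using assms finite_simple_graph_edges by (auto simp: finite_simple_graph_def)
  fix e and j :: "'v \<times> 'd" assume "e \<in> E" "j \<in> V \<times> UNIV"
  obtain a b where e: "e = {a, b}" "a \<noteq> b"
    using simple_graph_edge assms(1) \<open>e \<in> E\<close> unfolding finite_simple_graph_def by metis
  obtain u k where "j = (u, k)" by force
  have "continuous_on UNIV (\<lambda>p :: 'v \<Rightarrow> real ^ 'd. spow (q - 1) ((p a - p b) $ k))"
    using assms(2)
    by (intro continuous_on_compose2[OF continuous_on_spow[of _ UNIV]] continuous_intros) auto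
  then show "continuous_on UNIV (\<lambda>p :: 'v \<Rightarrow> real ^ 'd. altered_rigidity_matrix q p e j)"
    unfolding e(1) \<open>j = (u, k)\<close> altered_rigidity_matrix_edge[OF e(2)]
    by (intro continuous_intros)
qed

text \<open>Coinciding endpoints make the row of their edge zero, and a zero row carries a
  nontrivial relation.\<close>

lemma independent_framework_imp_placement:
  fixes p :: "'v \<Rightarrow> real ^ 'd"
  assumes "finite_simple_graph V E" "independent_framework q V E p"
  shows "placement E p"
  unfolding placement_def
proof (intro allI impI notI)
  fix v w assume vw: "{v, w} \<in> E" "p v = p w"
  have "v \<noteq> w" using assms(1) simple_graph_doubleton[OF _ vw(1)] by (auto simp: finite_simple_graph_def)
  have "(\<Sum>e\<in>E. (if e = {v, w} then 1 else 0) * altered_rigidity_matrix q p e j) = 0" for j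
  proof -
    have "(\<Sum>e\<in>E. (if e = {v, w} then 1 else 0) * altered_rigidity_matrix q p e j) =
        (\<Sum>e\<in>E. if e = {v, w} then altered_rigidity_matrix q p e j else 0)"
      by (intro sum.cong) auto
    then show ?thesis
      using finite_simple_graph_edges[OF assms(1)] vw \<open>v \<noteq> w\<close>
      by (cases j) (simp add: altered_rigidity_matrix_edge)
  qed
  from rows_lin_independentD[OF assms(2)[unfolded independent_framework_def] this vw(1)]
  show False by simp
qed

text \<open>The second hypothesis on \<open>c\<close> comes from pairing a self-stress of \<open>(V, E)\<close> with an
  infinitesimal flex \<open>z\<close> of the framework without \<open>v\<close>, extended by zero at \<open>v\<close>.\<close>

lemma independent_framework_add_vertex:
  fixes p :: "'v \<Rightarrow> real ^ 'd" and q :: real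
  defines "M \<equiv> altered_rigidity_matrix q p"
  assumes graph: "finite_simple_graph V E" and v: "v \<in> V"
    and indep: "independent_framework q (V - {v}) (del_vertex E v) p"
    and coeff: "\<And>c. (\<And>k. (\<Sum>w\<in>neighbours E v. c w * spow (q - 1) ((p v - p w) $ k)) = 0) \<Longrightarrow>
      (\<And>z. (\<And>e. e \<in> del_vertex E v \<Longrightarrow> (\<Sum>j\<in>(V - {v}) \<times> UNIV. M e j * z j) = 0) \<Longrightarrow>
        (\<Sum>w\<in>neighbours E v. c w * (\<Sum>k\<in>UNIV. spow (q - 1) ((p v - p w) $ k) * z (w, k))) = 0) \<Longrightarrow>
      \<forall>w\<in>neighbours E v. c w = 0"
  shows "independent_framework q V E p"
  unfolding independent_framework_def rows_lin_independent_def M_def[symmetric]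
proof (intro allI impI)
  fix a assume a: "\<forall>j\<in>V \<times> UNIV. (\<Sum>e\<in>E. a e * M e j) = 0"
  have simple: "simple_graph V E" and fin: "finite V" using graph by (auto simp: finite_simple_graph_def)
  have nb: "w \<noteq> v" "w \<in> V" if "w \<in> neighbours E v" for w
    using neighbours_subset[OF simple] that by auto
  have split: "(\<Sum>e\<in>del_vertex E v. a e * M e j) + (\<Sum>w\<in>neighbours E v. a {v, w} * M {v, w} j) = 0"
    if "j \<in> V \<times> UNIV" for j
    using bspec[OF a that] sum_edges_split[OF graph, of "\<lambda>e. a e * M e j" v] by simp
  have "\<forall>w\<in>neighbours E v. a {v, w} = 0"
  proof (rule coeff)
    fix k
    have "(\<Sum>e\<in>del_vertex E v. a e * M e (v, k)) = 0"
      by (intro sum.neutral) (auto simp: M_def del_vertex_def altered_rigidity_matrix_other)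
    moreover have "M {v, w} (v, k) = spow (q - 1) ((p v - p w) $ k)" if "w \<in> neighbours E v" for w
      using nb[OF that] by (auto simp: M_def altered_rigidity_matrix_edge)
    ultimately show "(\<Sum>w\<in>neighbours E v. a {v, w} * spow (q - 1) ((p v - p w) $ k)) = 0"
      using split[of "(v, k)"] v by (simp cong: sum.cong)
  next
    fix z assume z: "\<And>e. e \<in> del_vertex E v \<Longrightarrow> (\<Sum>j\<in>(V - {v}) \<times> UNIV. M e j * z j) = 0"
    have pair: "(\<Sum>j\<in>(V - {v}) \<times> UNIV. M {v, w} j * z j) =
        - (\<Sum>k\<in>UNIV. spow (q - 1) ((p v - p w) $ k) * z (w, k))" if "w \<in> neighbours E v" for w
      using nb[OF that] fin unfolding M_def
      by (subst rigidity_row_pairing) (auto simp: sum_negf)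
    \<comment> \<open>The column equations outside \<open>v\<close> are summed with weights
      \<open>z\<close>; the rows of the smaller framework vanish on the flex, which leaves only the
      edges at \<open>v\<close>.\<close>
    have "0 = (\<Sum>j\<in>(V - {v}) \<times> UNIV. ((\<Sum>e\<in>del_vertex E v. a e * M e j)
        + (\<Sum>w\<in>neighbours E v. a {v, w} * M {v, w} j)) * z j)"
      using split by (intro sum.neutral[symmetric]) auto
    also have "\<dots> = (\<Sum>e\<in>del_vertex E v. a e * (\<Sum>j\<in>(V - {v}) \<times> UNIV. M e j * z j))
        + (\<Sum>w\<in>neighbours E v. a {v, w} * (\<Sum>j\<in>(V - {v}) \<times> UNIV. M {v, w} j * z j))"
      unfolding distrib_right sum.distrib sum_distrib_left sum_distrib_right
      by (subst (1 2) sum.swap) (simp add: mult.assoc)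
    also have "\<dots> = - (\<Sum>w\<in>neighbours E v. a {v, w} * (\<Sum>k\<in>UNIV. spow (q - 1) ((p v - p w) $ k) * z (w, k)))"
      using z pair by (simp add: sum_negf)
    finally show "(\<Sum>w\<in>neighbours E v. a {v, w} * (\<Sum>k\<in>UNIV. spow (q - 1) ((p v - p w) $ k) * z (w, k))) = 0"
      by simp
  qed
  then have "(\<Sum>e\<in>del_vertex E v. a e * M e j) = 0" if "j \<in> (V - {v}) \<times> UNIV" for j
    using split[of j] that by auto
  from rows_lin_independentD[OF indep[unfolded independent_framework_def] this[unfolded M_def]]
  have "a e = 0" if "e \<in> del_vertex E v" for e using that by blast
  moreover have "e \<in> del_vertex E v \<or> e \<in> (\<lambda>w. {v, w}) ` neighbours E v" if "e \<in> E" for e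
    using that edges_at_eq_image[OF simple, of v] by (auto simp: del_vertex_def)
  ultimately show "\<forall>e\<in>E. a e = 0" using \<open>\<forall>w\<in>neighbours E v. a {v, w} = 0\<close> by blast
qed

section \<open>Vertices of small degree\<close>

lemma open_coordinate_slice:
  fixes x :: "real ^ 'd"
  assumes "open U" "x \<in> U"
  shows "open {s. (\<chi> i. if i = k then s else x $ i) \<in> U}"
    and "x $ k \<in> {s. (\<chi> i. if i = k then s else x $ i) \<in> U}"
proof -
  have "continuous_on UNIV (\<lambda>s. \<chi> i. if i = k then s else x $ i)"
  proof (rule continuous_on_vec_lambda)
    show "continuous_on UNIV (\<lambda>s. if i = k then s else x $ i)" for i
      by (cases "i = k") auto
  qed
  from open_vimage[OF assms(1) this] show "open {s. (\<chi> i. if i = k then s else x $ i) \<in> U}"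
    by (simp add: vimage_def)
  have "(\<chi> i. if i = k then x $ k else x $ i) = x" by (simp add: vec_eq_iff)
  then show "x $ k \<in> {s. (\<chi> i. if i = k then s else x $ i) \<in> U}" using assms(2) by simp
qed

lemma open_obtain_other:
  fixes S :: "real set"
  assumes "open S" "s \<in> S"
  obtains t where "t \<in> S" "t \<noteq> s"
proof -
  have "S \<noteq> {s}" using assms(1) not_open_singleton by metis
  then show ?thesis using assms(2) that by blast
qed

text \<open>Moving only the coordinate \<open>k\<close> within the open set changes a single term of
  the relation, and injectivity makes the factor of \<open>m k\<close> nonzero.\<close>

lemma locally_nondegenerate_coordinatewise:
  fixes \<rho> :: "'d::finite \<Rightarrow> real \<Rightarrow> real"
  assumes "\<And>k. inj (\<rho> k)"
  shows "locally_nondegenerate (\<lambda>(x :: real ^ 'd) k. \<rho> k (x $ k)) UNIV"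
  unfolding locally_nondegenerate_def
proof (intro allI impI ballI)
  fix m :: "'d \<Rightarrow> real" and U :: "(real ^ 'd) set" and k
  assume U: "open U" "U \<noteq> {}" and zero: "\<forall>x\<in>U. (\<Sum>j\<in>UNIV. \<rho> j (x $ j) * m j) = 0"
  obtain x where x: "x \<in> U" using U by blast
  obtain s where s: "(\<chi> i. if i = k then s else x $ i) \<in> U" "s \<noteq> x $ k"
    using open_obtain_other[OF open_coordinate_slice[OF U(1) x, of k]] by blast
  have "0 = (\<Sum>j\<in>UNIV. \<rho> j ((\<chi> i. if i = k then s else x $ i) $ j) * m j) - (\<Sum>j\<in>UNIV. \<rho> j (x $ j) * m j)"
    using bspec[OF zero s(1)] bspec[OF zero x] by simp
  also have "\<dots> = (\<Sum>j\<in>UNIV. if j = k then (\<rho> k s - \<rho> k (x $ k)) * m k else 0)"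
    unfolding sum_subtractf[symmetric] by (intro sum.cong) (auto simp: algebra_simps)
  finally have "(\<rho> k s - \<rho> k (x $ k)) * m k = 0" by simp
  then show "m k = 0" using s(2) injD[OF assms[of k]] by auto
qed

text \<open>The point of \<open>v\<close> stays and its neighbours are perturbed inside the open set
  of placements where the rest is independent. The edges at \<open>v\<close> then carry no stress
  that balances at \<open>v\<close>.\<close>

lemma independent_framework_extend_low_degree:
  fixes p :: "'v \<Rightarrow> real ^ 'd"
  assumes graph: "finite_simple_graph V E" and v: "v \<in> V" and q: "q > 1"
    and deg: "card (neighbours E v) \<le> CARD('d)"
    and indep: "independent_framework q (V - {v}) (del_vertex E v) p"
  shows "\<exists>p :: 'v \<Rightarrow> real ^ 'd. independent_framework q V E p"
proof -
  let ?W = "neighbours E v"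
  let ?U = "{p :: 'v \<Rightarrow> real ^ 'd. independent_framework q (V - {v}) (del_vertex E v) p}"
  have "open ?U"
    using independent_framework_open[OF finite_simple_graph_del_vertex[OF graph] q] .
  moreover have "locally_nondegenerate (\<lambda>x k. spow (q - 1) ((p v - x) $ k)) UNIV"
    using locally_nondegenerate_coordinatewise[of "\<lambda>k t. spow (q - 1) (p v $ k - t)"] q
    by (simp add: inj_def spow_eq_iff)
  ultimately obtain p' where p': "p' \<in> ?U" "\<forall>u. u \<notin> ?W \<longrightarrow> p' u = p u"
    "rows_lin_independent ?W UNIV (\<lambda>w k. spow (q - 1) ((p v - p' w) $ k))"
    using generic_rows_lin_independent[of ?W UNIV "\<lambda>w x k. spow (q - 1) ((p v - x) $ k)" ?U p]
      finite_neighbours[OF graph] deg indep by auto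
  have "v \<notin> ?W"
    using neighbours_subset graph unfolding finite_simple_graph_def by fast
  then have "p' v = p v" using p'(2) by simp
  have "independent_framework q V E p'"
  proof (rule independent_framework_add_vertex[OF graph v])
    show "independent_framework q (V - {v}) (del_vertex E v) p'" using p'(1) by simp
  next
    fix c assume "\<And>k. (\<Sum>w\<in>?W. c w * spow (q - 1) ((p' v - p' w) $ k)) = 0"
    then show "\<forall>w\<in>?W. c w = 0"
      using rows_lin_independentD[OF p'(3), of c] \<open>p' v = p v\<close> by auto
  qed
  then show ?thesis by blast
qed

section \<open>Vertices of degree one above the dimension\<close>

text \<open>The matrix obtained when \<open>v\<close> goes to infinity in direction
  \<open>k\<close>, with the flex column replaced. Up to sign, the columns \<open>Some l\<close>
  with \<open>l \<noteq> k\<close> belong to the choice 0 for the \<open>l\<close>-th coordinate of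
  \<open>v\<close>; column \<open>None\<close> belongs to the choice 1 for the \<open>j\<close>-th.
  Both choices for \<open>j\<close> thus occur side by side.\<close>

definition substituted_row :: "real \<Rightarrow> 'd \<Rightarrow> 'd \<Rightarrow> real ^ 'd \<Rightarrow> 'd option \<Rightarrow> real" where
  "substituted_row r k j x c = (case c of None \<Rightarrow> spow r (1 - x $ j)
     | Some l \<Rightarrow> if l = k then 1 else spow r (x $ l))"

lemma substituted_row_simps [simp]:
  "substituted_row r k j x None = spow r (1 - x $ j)"
  "substituted_row r k j x (Some l) = (if l = k then 1 else spow r (x $ l))"
  by (simp_all add: substituted_row_def)

text \<open>Varying coordinate \<open>j\<close> involves only the columns \<open>None\<close> and
  \<open>Some j\<close>, which are separated by \<open>spow_reflected_independent\<close>. Any other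
  coordinate \<open>l \<noteq> k\<close> isolates the column \<open>Some l\<close>, and finally the
  constant column \<open>Some k\<close> is left alone.\<close>

lemma locally_nondegenerate_substituted_row:
  fixes k j :: "'d::finite"
  assumes "r > 0" "r \<noteq> 1" "k \<noteq> j"
  shows "locally_nondegenerate (substituted_row r k j) UNIV"
  unfolding locally_nondegenerate_def
proof (intro allI impI)
  fix m :: "'d option \<Rightarrow> real" and U :: "(real ^ 'd) set"
  assume U: "open U" "U \<noteq> {}" and zero: "\<forall>x\<in>U. (\<Sum>c\<in>UNIV. substituted_row r k j x c * m c) = 0"
  obtain x where x: "x \<in> U" using U by blast
  define upd where "upd l s = (\<chi> i. if i = l then s else x $ i)" for l s
  define S where "S y = (\<Sum>c\<in>UNIV. substituted_row r k j y c * m c)" for y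
  have S_eq: "S y = spow r (1 - y $ j) * m None + (\<Sum>l\<in>UNIV. (if l = k then 1 else spow r (y $ l)) * m (Some l))" for y
    by (simp add: S_def sum_UNIV_option)
  have slice: "open {s. upd l s \<in> U}" "x $ l \<in> {s. upd l s \<in> U}" for l
    using open_coordinate_slice[OF U(1) x, of l] by (auto simp: upd_def)
  have S0: "S y = 0" if "y \<in> U" for y using zero that by (simp add: S_def)
  have diff: "S (upd l s) - S x = (spow r (1 - upd l s $ j) - spow r (1 - x $ j)) * m None
    + (spow r s - spow r (x $ l)) * m (Some l)" if "l \<noteq> k" for l s
  proof -
    have "(\<Sum>i\<in>UNIV. (if i = k then 1 else spow r (upd l s $ i)) * m (Some i))
      - (\<Sum>i\<in>UNIV. (if i = k then 1 else spow r (x $ i)) * m (Some i))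
      = (\<Sum>i\<in>UNIV. if i = l then (spow r s - spow r (x $ l)) * m (Some l) else 0)"
      unfolding sum_subtractf[symmetric] using that by (intro sum.cong) (auto simp: upd_def algebra_simps)
    then show ?thesis by (simp add: S_eq algebra_simps)
  qed
  have j: "m (Some j) = 0 \<and> m None = 0"
  proof (rule spow_reflected_independent[OF assms(1,2)])
    show "open {s. upd j s \<in> U}" "{s. upd j s \<in> U} \<noteq> {}" using slice[of j] by auto
    fix s assume "s \<in> {s. upd j s \<in> U}"
    then have "S (upd j s) - S x = 0" using S0 x by simp
    then show "- (spow r (1 - x $ j) * m None + spow r (x $ j) * m (Some j)) + m (Some j) * spow r s + m None * spow r (1 - s) = 0"
      using diff[of j s] assms(3) by (simp add: upd_def algebra_simps)
  qed
  have l: "m (Some l) = 0" if "l \<noteq> k" for l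
  proof -
    obtain s where s: "upd l s \<in> U" "s \<noteq> x $ l"
      using open_obtain_other[OF slice[of l]] by blast
    then have "(spow r s - spow r (x $ l)) * m (Some l) = 0"
      using diff[OF that, of s] S0 x j by simp
    then show ?thesis using s assms(1) by (simp add: spow_eq_iff)
  qed
  have "(\<Sum>l\<in>UNIV. (if l = k then 1 else spow r (x $ l)) * m (Some l)) = (\<Sum>l\<in>UNIV. if l = k then m (Some k) else 0)"
    using l by (intro sum.cong) auto
  then have "m (Some k) = 0" using S0[OF x] j by (simp add: S_eq)
  then show "\<forall>c\<in>UNIV. m c = 0" using j l by (metis option.exhaust)
qed

text \<open>Expand \<open>y\<close> in the columns of a substituted matrix. Either \<open>y\<close> can replace the column \<open>None\<close>,
  or, \<open>y\<close> not being constant, it involves some column \<open>i \<noteq> k\<close>, which it then replaces.\<close>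

lemma substituted_rows_exchange:
  fixes x :: "'v \<Rightarrow> real ^ 'd" and y :: "'v \<Rightarrow> real"
  assumes fin: "finite W" and "CARD('d) \<ge> 2"
    and generic: "\<And>j. k \<noteq> j \<Longrightarrow> rows_lin_independent W UNIV (\<lambda>w. substituted_row r k j (x w))"
    and y: "a \<in> W" "b \<in> W" "y a \<noteq> y b"
  shows "\<exists>t. rows_lin_independent W UNIV (\<lambda>w c. case c of None \<Rightarrow> y w
    | Some l \<Rightarrow> if l = k then 1 else spow r (t l - x w $ l))"
proof -
  obtain j where j: "k \<noteq> j" using assms(2) by (metis One_nat_def UNIV_I card_1_singleton_iff card_2_iff'
        card_le_Suc0_iff_eq finite not_less_eq_eq numeral_2_eq_2)
  obtain \<beta> where \<beta>: "\<And>w. w \<in> W \<Longrightarrow> (\<Sum>c\<in>UNIV. substituted_row r k j (x w) c * \<beta> c) = y w"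
    using rows_lin_independent_solve[OF fin _ generic[OF j], of y] by auto
  have comb: "(\<Sum>w\<in>W. g w * y w) = (\<Sum>c\<in>UNIV. \<beta> c * (\<Sum>w\<in>W. g w * substituted_row r k j (x w) c))" for g :: "'v \<Rightarrow> real"
  proof -
    have "(\<Sum>w\<in>W. g w * y w) = (\<Sum>w\<in>W. g w * (\<Sum>c\<in>UNIV. substituted_row r k j (x w) c * \<beta> c))"
      using \<beta> by (intro sum.cong) auto
    then show ?thesis
      unfolding sum_distrib_left by (subst sum.swap) (simp add: mult_ac)
  qed
  show ?thesis
  proof (cases "\<beta> None = 0")
    case False
    have "rows_lin_independent W UNIV (\<lambda>w c. case c of None \<Rightarrow> y w
      | Some l \<Rightarrow> if l = k then 1 else spow r (0 - x w $ l))"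
      unfolding rows_lin_independent_def
    proof (intro allI impI)
      fix g assume g: "\<forall>c\<in>UNIV. (\<Sum>w\<in>W. g w * (case c of None \<Rightarrow> y w
        | Some l \<Rightarrow> if l = k then 1 else spow r (0 - x w $ l))) = 0"
      have Some0: "(\<Sum>w\<in>W. g w * substituted_row r k j (x w) (Some l)) = 0" for l
        using bspec[OF g, of "Some l"] by (cases "l = k") (simp_all add: sum_negf)
      moreover have "(\<Sum>w\<in>W. g w * substituted_row r k j (x w) None) = 0"
        using bspec[OF g, of None] comb[of g] False Some0 by (simp only: sum_UNIV_option) simp
      ultimately have "(\<Sum>w\<in>W. g w * substituted_row r k j (x w) c) = 0" for c
        by (cases c) auto
      then show "\<forall>w\<in>W. g w = 0" using rows_lin_independentD[OF generic[OF j], of g] by blast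
    qed
    then show ?thesis by (rule exI[of _ "\<lambda>_. 0"])
  next
    case True
    have "\<exists>i. i \<noteq> k \<and> \<beta> (Some i) \<noteq> 0"
    proof (rule ccontr)
      assume no: "\<not> ?thesis"
      have "y w = \<beta> (Some k)" if "w \<in> W" for w
      proof -
        have "y w = (\<Sum>l\<in>UNIV. substituted_row r k j (x w) (Some l) * \<beta> (Some l))"
          using \<beta>[OF that] True by (simp add: sum_UNIV_option)
        also have "\<dots> = (\<Sum>l\<in>UNIV. if l = k then \<beta> (Some k) else 0)"
          using no by (intro sum.cong) auto
        finally show ?thesis by simp
      qed
      then show False using y by auto
    qed
    then obtain i where i: "i \<noteq> k" "\<beta> (Some i) \<noteq> 0" by blast
    \<comment> \<open>With coordinate \<open>i\<close> at 1 and the others at 0, the column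
      \<open>Some i\<close> becomes the column \<open>None\<close> of the substituted matrix for
      \<open>k\<close> and \<open>i\<close>.\<close>
    define t where "t l = (if l = i then 1 else 0 :: real)" for l
    have "rows_lin_independent W UNIV (\<lambda>w c. case c of None \<Rightarrow> y w
      | Some l \<Rightarrow> if l = k then 1 else spow r (t l - x w $ l))"
      unfolding rows_lin_independent_def
    proof (intro allI impI)
      fix g assume g: "\<forall>c\<in>UNIV. (\<Sum>w\<in>W. g w * (case c of None \<Rightarrow> y w
        | Some l \<Rightarrow> if l = k then 1 else spow r (t l - x w $ l))) = 0"
      have Some0: "(\<Sum>w\<in>W. g w * substituted_row r k j (x w) (Some l)) = 0" if "l \<noteq> i" for l j
        using bspec[OF g, of "Some l"] that by (cases "l = k") (simp_all add: sum_negf t_def)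
      have None0: "(\<Sum>w\<in>W. g w * substituted_row r k i (x w) None) = 0"
        using bspec[OF g, of "Some i"] i(1) by (simp add: t_def)
      have "0 = (\<Sum>w\<in>W. g w * y w)" using bspec[OF g, of None] by simp
      also have "\<dots> = (\<Sum>l\<in>UNIV. \<beta> (Some l) * (\<Sum>w\<in>W. g w * substituted_row r k j (x w) (Some l)))"
        unfolding comb using True by (simp add: sum_UNIV_option)
      also have "\<dots> = (\<Sum>l\<in>UNIV. if l = i then \<beta> (Some i) * (\<Sum>w\<in>W. g w * substituted_row r k j (x w) (Some i)) else 0)"
        using Some0 by (intro sum.cong) auto
      finally have "(\<Sum>w\<in>W. g w * substituted_row r k i (x w) (Some i)) = 0"
        using i by simp
      \<comment> \<open>The columns \<open>Some l\<close> are the same for \<open>j\<close> and for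
        \<open>i\<close>; the one missing, \<open>Some i\<close>, was recovered from the expansion
        of \<open>y\<close>, in which its coefficient is nonzero.\<close>
      then have "(\<Sum>w\<in>W. g w * substituted_row r k i (x w) c) = 0" for c
        using Some0 None0 by (cases c) (metis, metis)
      then show "\<forall>w\<in>W. g w = 0" using rows_lin_independentD[OF generic, of i g] i by blast
    qed
    then show ?thesis by (rule exI[of _ t])
  qed
qed

text \<open>For \<open>\<tau> T\<close> with \<open>k\<close>-th coordinate \<open>T\<close>, the
  column \<open>k\<close> and the flex column are divided by \<open>T powr r\<close>. In the limit
  only the summand \<open>l = k\<close> of the flex column survives, so the matrix tends to the one
  of \<open>substituted_rows_exchange\<close>, and independence holds for some finite
  \<open>T\<close> already.\<close>

lemma distant_point:
  fixes x :: "'v \<Rightarrow> real ^ 'd" and z :: "'v \<times> 'd \<Rightarrow> real"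
  assumes fin: "finite W" and "CARD('d) \<ge> 2" and "r > 0"
    and generic: "\<And>j. k \<noteq> j \<Longrightarrow> rows_lin_independent W UNIV (\<lambda>w. substituted_row r k j (x w))"
    and z: "a \<in> W" "b \<in> W" "z (a, k) \<noteq> z (b, k)"
  shows "\<exists>\<tau> :: real ^ 'd. \<forall>c. (\<forall>l. (\<Sum>w\<in>W. c w * spow r ((\<tau> - x w) $ l)) = 0) \<longrightarrow>
    (\<Sum>w\<in>W. c w * (\<Sum>l\<in>UNIV. spow r ((\<tau> - x w) $ l) * z (w, l))) = 0 \<longrightarrow> (\<forall>w\<in>W. c w = 0)"
proof -
  obtain t where t: "rows_lin_independent W UNIV (\<lambda>w c. case c of None \<Rightarrow> z (w, k)
      | Some l \<Rightarrow> if l = k then 1 else spow r (t l - x w $ l))"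
    using substituted_rows_exchange[OF fin assms(2) generic, where y = "\<lambda>w. z (w, k)"] z by blast
  define \<tau> where "\<tau> T = (\<chi> l. if l = k then T else t l)" for T
  define X where "X T w c = (case c of None \<Rightarrow> (\<Sum>l\<in>UNIV. spow r ((\<tau> T - x w) $ l) * z (w, l)) / T powr r
      | Some l \<Rightarrow> spow r ((\<tau> T - x w) $ l) / (if l = k then T powr r else 1))" for T w c
  have inv: "((\<lambda>T. c / T powr r) \<longlongrightarrow> 0) at_top" for c
    using assms(3) by real_asymp
  have lim: "((\<lambda>T. spow r ((\<tau> T - x w) $ l) / T powr r) \<longlongrightarrow> (if l = k then 1 else 0)) at_top" for w l
    using spow_shift_asymp[of r "x w $ k"] inv by (auto simp: \<tau>_def)
  have "eventually (\<lambda>T. rows_lin_independent W UNIV (X T)) at_top"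
  proof (rule rows_lin_independent_eventually[OF fin _ t])
    fix w and c :: "'d option"
    show "((\<lambda>T. X T w c) \<longlongrightarrow> (case c of None \<Rightarrow> z (w, k)
      | Some l \<Rightarrow> if l = k then 1 else spow r (t l - x w $ l))) at_top"
    proof (cases c)
      case None
      have "((\<lambda>T. \<Sum>l\<in>UNIV. spow r ((\<tau> T - x w) $ l) / T powr r * z (w, l))
          \<longlongrightarrow> (\<Sum>l\<in>UNIV. (if l = k then 1 else 0) * z (w, l))) at_top"
        by (intro tendsto_intros lim)
      moreover have "(\<Sum>l\<in>UNIV. (if l = k then 1 else 0) * z (w, l)) = (\<Sum>l\<in>UNIV. if l = k then z (w, k) else 0)"
        by (intro sum.cong) auto
      ultimately show ?thesis using None by (simp add: X_def sum_divide_distrib)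
    next
      case (Some l)
      show ?thesis
      proof (cases "l = k")
        case True
        then show ?thesis using lim[of w l] Some by (simp add: X_def)
      next
        case False
        then show ?thesis using Some by (simp add: X_def \<tau>_def)
      qed
    qed
  qed auto
  then have "eventually (\<lambda>T. rows_lin_independent W UNIV (X T) \<and> T > 0) at_top"
    using eventually_gt_at_top[of 0] by (rule eventually_conj)
  then obtain T where T: "rows_lin_independent W UNIV (X T)" "T > 0"
    using eventually_happens'[OF trivial_limit_at_top_linorder] by blast
  show ?thesis
  proof (intro exI[of _ "\<tau> T"] allI impI)
    fix c
    assume 1: "\<forall>l. (\<Sum>w\<in>W. c w * spow r ((\<tau> T - x w) $ l)) = 0"
      and 2: "(\<Sum>w\<in>W. c w * (\<Sum>l\<in>UNIV. spow r ((\<tau> T - x w) $ l) * z (w, l))) = 0"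
    have "(\<Sum>w\<in>W. c w * X T w i) = 0" for i
    proof (cases i)
      case None
      then show ?thesis using 2
        by (simp add: X_def sum_divide_distrib[symmetric])
    next
      case (Some l)
      have "(\<Sum>w\<in>W. c w * X T w i) =
          (\<Sum>w\<in>W. c w * spow r ((\<tau> T - x w) $ l)) / (if l = k then T powr r else 1)"
        unfolding sum_divide_distrib using Some by (simp add: X_def)
      then show ?thesis using 1 by simp
    qed
    then show "\<forall>w\<in>W. c w = 0" using rows_lin_independentD[OF T(1), of c] by blast
  qed
qed

text \<open>The flex, and with it the coordinate \<open>k\<close> that it separates, is known only
  once the placement is fixed. The placement is therefore first made generic for all pairs
  \<open>k \<noteq> j\<close>; then the flex is chosen, and last the point of \<open>v\<close>, on
  which the smaller framework does not depend.\<close>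

lemma independent_framework_extend_by_flex:
  fixes U :: "('v \<Rightarrow> real ^ 'd) set"
  assumes graph: "finite_simple_graph V E" and v: "v \<in> V" and q: "q > 1" "q \<noteq> 2"
    and d: "CARD('d) \<ge> 2" and deg: "card (neighbours E v) \<le> CARD('d) + 1"
    and U: "open U" "U \<noteq> {}"
    and indep: "\<And>p. p \<in> U \<Longrightarrow> independent_framework q (V - {v}) (del_vertex E v) p"
    and flex: "\<And>p. p \<in> U \<Longrightarrow> \<exists>z. (\<forall>e\<in>del_vertex E v.
        (\<Sum>j\<in>(V - {v}) \<times> UNIV. altered_rigidity_matrix q p e j * z j) = 0) \<and>
      (\<exists>a\<in>neighbours E v. \<exists>b\<in>neighbours E v. \<exists>k. z (a, k) \<noteq> z (b, k))"
  shows "\<exists>p :: 'v \<Rightarrow> real ^ 'd. independent_framework q V E p"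
proof -
  let ?W = "neighbours E v"
  define D where "D = (\<lambda>(k, j). {p :: 'v \<Rightarrow> real ^ 'd.
    rows_lin_independent ?W UNIV (\<lambda>w. substituted_row (q - 1) k j (p w))})"
  have fin: "finite ?W" using finite_neighbours[OF graph] .
  have "U \<inter> (\<Inter>c\<in>{(k, j). k \<noteq> j}. D c) \<noteq> {} \<and> open (U \<inter> (\<Inter>c\<in>{(k, j). k \<noteq> j}. D c))"
  proof (rule finite_dense_open_Int[OF _ U])
    fix c :: "'d \<times> 'd" assume "c \<in> {(k, j). k \<noteq> j}"
    then obtain k j where c: "c = (k, j)" "k \<noteq> j" by auto
    have "continuous_on UNIV (\<lambda>p :: 'v \<Rightarrow> real ^ 'd. substituted_row (q - 1) k j (p w) i)" for w i
    proof (cases i)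
      case None
      then show ?thesis
        using q by (auto intro!: continuous_intros continuous_on_compose2[OF continuous_on_spow[of _ UNIV]])
    next
      case (Some l)
      then show ?thesis
        using q by (cases "l = k") (auto intro!: continuous_intros continuous_on_compose2[OF continuous_on_spow[of _ UNIV]])
    qed
    then show "open (D c)"
      unfolding D_def c using fin by (simp add: rows_lin_independent_open)
    fix U' :: "('v \<Rightarrow> real ^ 'd) set" assume U': "open U'" "U' \<noteq> {}"
    then obtain p where "p \<in> U'" by blast
    moreover have "locally_nondegenerate (substituted_row (q - 1) k j) UNIV"
      using q c by (intro locally_nondegenerate_substituted_row) auto
    moreover have "card ?W \<le> card (UNIV :: 'd option set)" using deg by (simp add: card_UNIV_option)
    ultimately show "U' \<inter> D c \<noteq> {}"
      using generic_rows_lin_independent[of ?W UNIV "\<lambda>_. substituted_row (q - 1) k j" U' p] fin U'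
      unfolding D_def c by fastforce
  qed auto
  then obtain p where p: "p \<in> U" "\<And>k j. k \<noteq> j \<Longrightarrow> rows_lin_independent ?W UNIV (\<lambda>w. substituted_row (q - 1) k j (p w))"
    unfolding D_def by fastforce
  obtain z a b k where z: "\<And>e. e \<in> del_vertex E v \<Longrightarrow>
      (\<Sum>j\<in>(V - {v}) \<times> UNIV. altered_rigidity_matrix q p e j * z j) = 0"
    and ab: "a \<in> ?W" "b \<in> ?W" "z (a, k) \<noteq> z (b, k)"
    using flex[OF p(1)] by blast
  obtain \<tau> :: "real ^ 'd" where \<tau>: "\<And>c. \<lbrakk>\<forall>l. (\<Sum>w\<in>?W. c w * spow (q - 1) ((\<tau> - p w) $ l)) = 0;
    (\<Sum>w\<in>?W. c w * (\<Sum>l\<in>UNIV. spow (q - 1) ((\<tau> - p w) $ l) * z (w, l))) = 0\<rbrakk> \<Longrightarrow> \<forall>w\<in>?W. c w = 0"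
    using distant_point[OF fin d _ p(2) ab] q by auto
  define p' where "p' = p(v := \<tau>)"
  have simple: "simple_graph V E" using graph by (simp add: finite_simple_graph_def)
  have nb: "p' w = p w" if "w \<in> ?W" for w
    using that neighbours_subset[OF simple, of v] by (auto simp: p'_def)
  have matrix: "altered_rigidity_matrix q p' e j = altered_rigidity_matrix q p e j" if e: "e \<in> del_vertex E v" for e j
  proof -
    have "e \<in> E" "v \<notin> e" using e by (auto simp: del_vertex_def)
    moreover obtain a b where "e = {a, b}" "a \<noteq> b"
      using simple_graph_edge[OF simple \<open>e \<in> E\<close>] .
    ultimately show ?thesis by (cases j) (auto simp: altered_rigidity_matrix_edge p'_def)
  qed
  have "independent_framework q V E p'"
  proof (rule independent_framework_add_vertex[OF graph v])
    show "independent_framework q (V - {v}) (del_vertex E v) p'"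
      using indep[OF p(1)] matrix
      by (simp add: independent_framework_def rows_lin_independent_def cong: sum.cong)
  next
    fix c
    assume 1: "\<And>k. (\<Sum>w\<in>?W. c w * spow (q - 1) ((p' v - p' w) $ k)) = 0"
      and 2: "\<And>z. (\<And>e. e \<in> del_vertex E v \<Longrightarrow>
          (\<Sum>j\<in>(V - {v}) \<times> UNIV. altered_rigidity_matrix q p' e j * z j) = 0) \<Longrightarrow>
        (\<Sum>w\<in>?W. c w * (\<Sum>k\<in>UNIV. spow (q - 1) ((p' v - p' w) $ k) * z (w, k))) = 0"
    show "\<forall>w\<in>?W. c w = 0"
    proof (rule \<tau>)
      show "\<forall>l. (\<Sum>w\<in>?W. c w * spow (q - 1) ((\<tau> - p w) $ l)) = 0"
        using 1 nb by (simp add: p'_def cong: sum.cong)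
      have "(\<Sum>w\<in>?W. c w * (\<Sum>k\<in>UNIV. spow (q - 1) ((p' v - p' w) $ k) * z (w, k))) = 0"
        using z matrix by (intro 2) simp
      then show "(\<Sum>w\<in>?W. c w * (\<Sum>l\<in>UNIV. spow (q - 1) ((\<tau> - p w) $ l) * z (w, l))) = 0"
        using nb by (simp add: p'_def cong: sum.cong)
    qed
  qed
  then show ?thesis by blast
qed

section \<open>Flexes that move neighbours apart\<close>

lemma del_vertex_edge:
  assumes "finite_simple_graph V E" "e \<in> del_vertex E v"
  obtains a b where "e = {a, b}" "a \<noteq> b" "a \<in> V - {v}" "b \<in> V - {v}" "{a, b} \<in> E"
proof -
  have "e \<in> E" "v \<notin> e" using assms(2) by (auto simp: del_vertex_def)
  obtain a b where "e = {a, b}" "a \<noteq> b" "a \<in> V" "b \<in> V"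
    using simple_graph_edge[of V E e] assms(1) \<open>e \<in> E\<close> unfolding finite_simple_graph_def by metis
  then show ?thesis using that \<open>e \<in> E\<close> \<open>v \<notin> e\<close> by blast
qed

text \<open>The set \<open>A\<close> is translated by the all-ones vector and the rest is fixed; no
  edge joins the two parts, so both ends of every edge have the same velocity.\<close>

lemma flex_of_closed_set:
  fixes p :: "'v \<Rightarrow> real ^ 'd"
  assumes graph: "finite_simple_graph V E"
    and closed: "\<And>a b. {a, b} \<in> del_vertex E v \<Longrightarrow> a \<in> A \<Longrightarrow> b \<in> A" and e: "e \<in> del_vertex E v"
  shows "(\<Sum>j\<in>(V - {v}) \<times> UNIV. altered_rigidity_matrix q p e j * of_bool (fst j \<in> A)) = 0"
proof -
  obtain a b where ab: "e = {a, b}" "a \<noteq> b" "a \<in> V - {v}" "b \<in> V - {v}"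
    using del_vertex_edge[OF graph e] .
  have "a \<in> A \<longleftrightarrow> b \<in> A" using closed[of a b] closed[of b a] e ab(1) by (auto simp: insert_commute)
  then show ?thesis
    using graph ab by (simp only: ab(1)) (subst rigidity_row_pairing; auto simp: finite_simple_graph_def)
qed

text \<open>The dual vector of the added row vanishes on all rows of \<open>E\<close> but pairs to 1
  with the row of \<open>{x, y}\<close>, so it cannot agree at \<open>x\<close> and
  \<open>y\<close>.\<close>

lemma flex_of_missing_edge:
  fixes p :: "'v \<Rightarrow> real ^ 'd"
  assumes graph: "finite_simple_graph V E" and xy: "x \<in> V" "y \<in> V" "x \<noteq> y" "{x, y} \<notin> E"
    and indep: "independent_framework q V (insert {x, y} E) p"
  shows "\<exists>z. (\<forall>e\<in>E. (\<Sum>j\<in>V \<times> UNIV. altered_rigidity_matrix q p e j * z j) = 0) \<and> (\<exists>k. z (x, k) \<noteq> z (y, k))"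
proof -
  have fin: "finite V" "finite E"
    using graph finite_simple_graph_edges by (auto simp: finite_simple_graph_def)
  then have fin': "finite (insert {x, y} E)" "finite (V \<times> (UNIV :: 'd set))" by auto
  obtain N where N: "\<And>e e'. e \<in> insert {x, y} E \<Longrightarrow> e' \<in> insert {x, y} E \<Longrightarrow>
      (\<Sum>j\<in>V \<times> UNIV. altered_rigidity_matrix q p e j * N e' j) = (if e = e' then 1 else 0)"
    using rows_lin_independent_dual[OF fin' indep[unfolded independent_framework_def]] by blast
  have "(\<Sum>k\<in>UNIV. spow (q - 1) ((p x - p y) $ k) * (N {x, y} (x, k) - N {x, y} (y, k))) = 1"
    using N[of "{x, y}" "{x, y}"] rigidity_row_pairing[OF fin(1) xy(3), of q p "N {x, y}"] xy by simp
  moreover have "(\<Sum>k\<in>UNIV. spow (q - 1) ((p x - p y) $ k) * (N {x, y} (x, k) - N {x, y} (y, k))) = 0"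
    if "\<And>k. N {x, y} (x, k) = N {x, y} (y, k)"
    using that by simp
  ultimately have "\<exists>k. N {x, y} (x, k) \<noteq> N {x, y} (y, k)" by fastforce
  moreover have "(\<Sum>j\<in>V \<times> UNIV. altered_rigidity_matrix q p e j * N {x, y} j) = 0" if "e \<in> E" for e
    using N[of e "{x, y}"] that xy(4) by auto
  ultimately show ?thesis by blast
qed

text \<open>In the situation of the next lemma every \<open>w \<in> W\<close> has at most one neighbour \<open>u\<close> outside
  \<open>insert v W\<close>. A flex supported on \<open>W\<close> satisfies one equation for each pair in \<open>W\<close> and one for each
  such edge \<open>wu\<close>; for \<open>d \<ge> 3\<close> this leaves a nonzero solution, and it is not a translation on \<open>W\<close>
  because generically \<open>d\<close> of the vectors of the edges \<open>wu\<close> are linearly independent.\<close>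

lemma flex_of_clique:
  fixes p0 :: "'v \<Rightarrow> real ^ 'd" and E :: "'v set set" and v :: 'v
  defines "W \<equiv> neighbours E v"
  assumes graph: "finite_simple_graph V E" and q: "q > 1" and d: "CARD('d) \<ge> 3"
    and card_W: "card (W) = CARD('d) + 1"
    and clique: "\<And>a b. a \<in> W \<Longrightarrow> b \<in> W \<Longrightarrow> a \<noteq> b \<Longrightarrow> {a, b} \<in> E"
    and deg: "\<And>w. w \<in> W \<Longrightarrow> card (neighbours E w) \<le> CARD('d) + 2"
    and U: "open U" "p0 \<in> U"
  shows "\<exists>U' \<subseteq> U. open U' \<and> U' \<noteq> {} \<and> (\<forall>p\<in>U'. \<exists>z. (\<forall>e\<in>del_vertex E v.
        (\<Sum>j\<in>(V - {v}) \<times> UNIV. altered_rigidity_matrix q p e j * z j) = 0) \<and>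
      (\<exists>a\<in>neighbours E v. \<exists>b\<in>neighbours E v. \<exists>k. z (a, k) \<noteq> z (b, k)))"
proof -
  have simple: "simple_graph V E" and finV: "finite V" using graph by (auto simp: finite_simple_graph_def)
  have finW: "finite W" and WV: "W \<subseteq> V - {v}"
    using finite_neighbours[OF graph] neighbours_subset[OF simple] by (auto simp: W_def)
  define outer where "outer w = {u. {w, u} \<in> E \<and> u \<noteq> v \<and> u \<notin> W}" for w
  have outer_unique: "u = u'" if w: "w \<in> W" and "u \<in> outer w" "u' \<in> outer w" for w u u'
  proof (rule ccontr)
    assume "u \<noteq> u'"
    \<comment> \<open>Two outer neighbours, \<open>v\<close>, and the \<open>CARD('d)\<close> other
      members of the clique exceed the degree bound by one.\<close>
    have "insert u (insert u' (insert v (W - {w}))) \<subseteq> neighbours E w"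
      using that clique[OF w] by (auto simp: outer_def W_def neighbours_def insert_commute)
    moreover have "card (insert u (insert u' (insert v (W - {w})))) = CARD('d) + 3"
      using that \<open>u \<noteq> u'\<close> card_W finW WV by (auto simp: outer_def card_insert_if)
    ultimately have "CARD('d) + 3 \<le> card (neighbours E w)"
      by (metis card_mono finite_neighbours[OF graph])
    then show False using deg[OF w] by simp
  qed
  define \<pi> where "\<pi> w = (SOME u. u \<in> outer w)" for w
  have \<pi>: "u = \<pi> w" if "w \<in> W" "u \<in> outer w" for u w
    using outer_unique[OF that(1) that(2)] someI[of "\<lambda>u. u \<in> outer w"] that(2) unfolding \<pi>_def by blast
  \<comment> \<open>A vertex without outer neighbour gets the origin as a dummy one, so that every
    \<open>w\<close> in \<open>W\<close> contributes exactly one equation.\<close>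
  define base where "base p w = (if outer w = {} then 0 else p (\<pi> w))" for p :: "'v \<Rightarrow> real ^ 'd" and w
  have "card W > 0" using card_W by simp
  then obtain w0 where w0: "w0 \<in> W" by fastforce
  \<comment> \<open>One vertex is dropped to make the system square: \<open>CARD('d)\<close> rows in
    as many columns.\<close>
  define W' where "W' = W - {w0}"
  have card_W': "card W' = CARD('d)" "finite W'"
    using card_W finW w0 by (auto simp: W'_def)
  define D where "D = {p. rows_lin_independent W' UNIV (\<lambda>w k. spow (q - 1) ((p w - base p w) $ k))}"
  have "open D" unfolding D_def
  proof (rule rows_lin_independent_open[OF card_W'(2)])
    fix w k
    have "continuous_on UNIV (\<lambda>p. base p w)"
      by (cases "outer w = {}") (auto simp: base_def)
    then show "continuous_on UNIV (\<lambda>p. spow (q - 1) ((p w - base p w) $ k))"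
      using q by (intro continuous_on_compose2[OF continuous_on_spow[of _ UNIV]] continuous_intros) auto
  qed simp
  have "locally_nondegenerate (\<lambda>x k. spow (q - 1) ((x - base p0 w) $ k)) UNIV" for w
    using locally_nondegenerate_coordinatewise[of "\<lambda>k t. spow (q - 1) (t - base p0 w $ k)"] q
    by (simp add: inj_def spow_eq_iff)
  then obtain p1 where p1: "p1 \<in> U" "\<And>u. u \<notin> W' \<Longrightarrow> p1 u = p0 u"
    "rows_lin_independent W' UNIV (\<lambda>w k. spow (q - 1) ((p1 w - base p0 w) $ k))"
    using generic_rows_lin_independent[of W' UNIV "\<lambda>w x k. spow (q - 1) ((x - base p0 w) $ k)" U p0]
      card_W' U by auto
  \<comment> \<open>Base points are the origin or points of vertices outside \<open>W\<close>, so
    the perturbation of \<open>W'\<close> leaves them in place.\<close>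
  have "base p1 w = base p0 w" if "w \<in> W'" for w
  proof (cases "outer w = {}")
    case False
    then have "\<pi> w \<in> outer w" unfolding \<pi>_def by (simp add: some_in_eq)
    then have "\<pi> w \<notin> W'" by (auto simp: outer_def W'_def)
    then show ?thesis using p1(2) by (simp add: base_def)
  qed (simp add: base_def)
  then have "p1 \<in> D" using p1(3) by (simp add: D_def rows_lin_independent_def cong: sum.cong)
  have flex: "\<exists>z. (\<forall>e\<in>del_vertex E v.
        (\<Sum>j\<in>(V - {v}) \<times> UNIV. altered_rigidity_matrix q p e j * z j) = 0) \<and>
      (\<exists>a\<in>W. \<exists>b\<in>W. \<exists>k. z (a, k) \<noteq> z (b, k))" if p: "p \<in> D" for p
  proof -
    \<comment> \<open>\<open>Inl\<close> tags the edges inside \<open>W\<close> and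
      \<open>Inr\<close> the edges to base points. With \<open>d = CARD('d)\<close> these are
      \<open>d (d + 1) / 2 + (d + 1)\<close> equations in \<open>d (d + 1)\<close> unknowns; their
      number is smaller because \<open>d \<ge> 3\<close>.\<close>
    define R where "R = {e. e \<subseteq> W \<and> card e = 2} <+> W"
    define M where "M i = (case i of Inl e \<Rightarrow> altered_rigidity_matrix q p e
      | Inr w \<Rightarrow> (\<lambda>(u, k). of_bool (u = w) * spow (q - 1) ((p w - base p w) $ k)))" for i
    have finR: "finite {e. e \<subseteq> W \<and> card e = 2}"
      using finW by (auto intro: finite_subset[of _ "Pow W"])
    then have "finite R" using finW by (simp add: R_def)
    have "card R = card {e. e \<subseteq> W \<and> card e = 2} + card W"
      unfolding R_def using finR finW by (rule card_Plus)
    then have "card R = (CARD('d) + 1) * CARD('d) div 2 + (CARD('d) + 1)"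
      using n_subsets[OF finW, of 2] card_W by (simp add: choose_two)
    also have "\<dots> < (CARD('d) + 1) * CARD('d)"
    proof -
      have "(CARD('d) + 1) * 3 \<le> (CARD('d) + 1) * CARD('d)" using d by (intro mult_le_mono2)
      moreover have "x div 2 + m < x" if "m * 3 \<le> x" "m > 0" for x m :: nat
        using that by linarith
      ultimately show ?thesis by simp
    qed
    also have "\<dots> = card (W \<times> (UNIV :: 'd set))" using card_W by (simp add: card_cartesian_product)
    finally obtain y where y: "\<exists>j\<in>W \<times> UNIV. y j \<noteq> 0"
      "\<And>i. i \<in> R \<Longrightarrow> (\<Sum>j\<in>W \<times> UNIV. M i j * y j) = 0"
      using underdetermined_solution[of R "W \<times> (UNIV :: 'd set)" M] \<open>finite R\<close> finW by auto
    define z where "z j = (if fst j \<in> W then y j else 0)" for j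
    have pin: "(\<Sum>k\<in>UNIV. spow (q - 1) ((p w - base p w) $ k) * y (w, k)) = 0" if w: "w \<in> W" for w
    proof -
      have "(\<Sum>j\<in>W \<times> UNIV. M (Inr w) j * y j) = 0" using w by (intro y(2)) (auto simp: R_def)
      then have "(\<Sum>u\<in>W. \<Sum>k\<in>UNIV. of_bool (u = w) * spow (q - 1) ((p w - base p w) $ k) * y (u, k)) = 0"
        by (simp add: M_def sum.cartesian_product split_beta)
      moreover have "(\<Sum>k\<in>UNIV. of_bool (u = w) * spow (q - 1) ((p w - base p w) $ k) * y (u, k)) =
        (if u = w then \<Sum>k\<in>UNIV. spow (q - 1) ((p w - base p w) $ k) * y (w, k) else 0)" for u
        by simp
      ultimately show ?thesis using finW w by simp
    qed
    have z_flex: "(\<Sum>j\<in>(V - {v}) \<times> UNIV. altered_rigidity_matrix q p e j * z j) = 0"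
      if e: "e \<in> del_vertex E v" for e
    proof -
      obtain a b where ab: "e = {a, b}" "a \<noteq> b" "a \<in> V - {v}" "b \<in> V - {v}" "{a, b} \<in> E"
        using del_vertex_edge[OF graph e] .
      have pair: "(\<Sum>j\<in>(V - {v}) \<times> UNIV. altered_rigidity_matrix q p {a, b} j * z j) =
        (\<Sum>k\<in>UNIV. spow (q - 1) ((p a - p b) $ k) * (z (a, k) - z (b, k)))"
        if "a \<noteq> b" "a \<in> V - {v}" "b \<in> V - {v}" for a b
        using rigidity_row_pairing[of "V - {v}" a b q p z] that finV by simp
      have one_end: "(\<Sum>j\<in>(V - {v}) \<times> UNIV. altered_rigidity_matrix q p {a, b} j * z j) = 0"
        if "a \<noteq> b" "a \<in> V - {v}" "b \<in> V - {v}" "{a, b} \<in> E" "a \<in> W" "b \<notin> W" for a b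
      proof -
        have "b \<in> outer a" using that by (simp add: outer_def)
        then have "base p a = p b" using \<pi>[OF \<open>a \<in> W\<close>] by (auto simp: base_def)
        then show ?thesis using pair[OF that(1-3)] pin[OF \<open>a \<in> W\<close>] that by (simp add: z_def)
      qed
      consider "a \<in> W" "b \<in> W" | "a \<in> W" "b \<notin> W" | "a \<notin> W" "b \<in> W" | "a \<notin> W" "b \<notin> W" by blast
      then show ?thesis
      proof cases
        case 1
        then have "(\<Sum>j\<in>W \<times> UNIV. M (Inl {a, b}) j * y j) = 0"
          using ab(2) by (intro y(2)) (auto simp: R_def)
        then show ?thesis
          using 1 pair[OF ab(2-4)] rigidity_row_pairing[OF finW ab(2), of q p y] by (simp add: M_def ab(1) z_def)
      next
        case 2
        then show ?thesis using one_end ab by blast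
      next
        case 3
        then show ?thesis using one_end[of b a] ab by (simp add: insert_commute)
      next
        case 4
        then show ?thesis using pair[OF ab(2-4)] by (simp add: ab(1) z_def)
      qed
    qed
    have "\<exists>a\<in>W. \<exists>b\<in>W. \<exists>k. z (a, k) \<noteq> z (b, k)"
    proof (rule ccontr)
      assume "\<not> ?thesis"
      then have same: "z (a, k) = z (b, k)" if "a \<in> W" "b \<in> W" for a b k
        using that by blast
      have const: "y (a, k) = y (w0, k)" if "a \<in> W" for a k
        using same[OF that w0, of k] that w0 by (simp add: z_def)
      have "y (w0, k) = 0" for k
      proof (rule rows_lin_independent_kernel[where m = "\<lambda>k. y (w0, k)"])
        show "rows_lin_independent W' UNIV (\<lambda>w k. spow (q - 1) ((p w - base p w) $ k))"
          using p by (simp add: D_def)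
        show "card (UNIV :: 'd set) \<le> card W'" "finite W'" using card_W' by auto
        fix w assume "w \<in> W'"
        then have "w \<in> W" by (simp add: W'_def)
        then show "(\<Sum>k\<in>UNIV. spow (q - 1) ((p w - base p w) $ k) * y (w0, k)) = 0"
          using pin[of w] by (simp add: const[of w])
      qed auto
      moreover obtain a k where "a \<in> W" "y (a, k) \<noteq> 0" using y(1) by blast
      ultimately show False using const[of a k] by simp
    qed
    then show ?thesis using z_flex by blast
  qed
  have "p1 \<in> U \<inter> D" "open (U \<inter> D)" using p1(1) \<open>p1 \<in> D\<close> \<open>open D\<close> U by auto
  then show ?thesis using flex unfolding W_def by (intro exI[of _ "U \<inter> D"]) blast
qed

section \<open>Sparsity and independence from the degree conditions\<close>

text \<open>Up to \<open>2 * d\<close> vertices the number of pairs bounds the edges well enough;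
  beyond that the degree sum does, since \<open>2 * d \<le> (d - 2) * n\<close>.\<close>

lemma dd_sparse_of_max_degree:
  assumes graph: "finite_simple_graph V E" and d: "d \<ge> 3"
    and deg: "\<And>v. v \<in> V \<Longrightarrow> vertex_degree E v \<le> d + 2"
  shows "dd_sparse d V E"
  unfolding dd_sparse_def
proof (intro allI impI, elim conjE)
  fix V' E' assume sub: "subgraph V' E' V E" and "V' \<noteq> {}"
  have simple: "simple_graph V' E'" "V' \<subseteq> V" "E' \<subseteq> E" using sub by (auto simp: subgraph_def)
  have fin: "finite V'" "finite E" "finite E'"
    using simple graph finite_simple_graph_edges[OF graph] finite_subset by (auto simp: finite_simple_graph_def)
  define n where "n = card V'"
  have "n > 0" using fin \<open>V' \<noteq> {}\<close> by (simp add: n_def card_gt_0_iff)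
  have few: "card E' \<le> n choose 2"
  proof -
    have "E' \<subseteq> {e. e \<subseteq> V' \<and> card e = 2}" using simple by (auto simp: simple_graph_def)
    then have "card E' \<le> card {e. e \<subseteq> V' \<and> card e = 2}"
      using fin by (intro card_mono) (auto intro: finite_subset[of _ "Pow V'"])
    then show ?thesis using n_subsets[OF fin(1), of 2] by (simp add: n_def)
  qed
  have handshake: "2 * card E' \<le> (d + 2) * n"
  proof -
    have "2 * card E' = (\<Sum>e\<in>E'. card {v \<in> V'. v \<in> e})"
    proof -
      have "{v \<in> V'. v \<in> e} = e" "card e = 2" if "e \<in> E'" for e
        using simple that by (auto simp: simple_graph_def)
      then show ?thesis by simp
    qed
    also have "\<dots> = (\<Sum>v\<in>V'. card {e \<in> E'. v \<in> e})"
      using fin by (intro sum_multicount_gen[symmetric]) auto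
    also have "\<dots> \<le> (\<Sum>v\<in>V'. d + 2)"
    proof (rule sum_mono)
      fix v assume "v \<in> V'"
      have "card {e \<in> E'. v \<in> e} \<le> vertex_degree E v"
        unfolding vertex_degree_def using simple fin by (intro card_mono) auto
      then show "card {e \<in> E'. v \<in> e} \<le> d + 2" using deg[of v] \<open>v \<in> V'\<close> simple by auto
    qed
    finally show ?thesis by (simp add: n_def mult.commute)
  qed
  have "card E' + d \<le> d * n"
  proof (cases "n \<le> 2 * d")
    case True
    have "2 * card E' \<le> n * (n - 1)" using few by (simp add: choose_two)
    also have "\<dots> \<le> (2 * d) * (n - 1)" using True by (intro mult_le_mono1)
    finally have "card E' \<le> d * (n - 1)" by simp
    moreover have "d * n = d * (n - 1) + d" using \<open>n > 0\<close> by (cases n) auto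
    ultimately show ?thesis by simp
  next
    case False
    \<comment> \<open>Writing \<open>d = c + 2\<close> avoids truncated subtraction in the final
      inequality.\<close>
    define c where "c = d - 2"
    then have c: "d = c + 2" "c \<ge> 1" using d by auto
    have "2 * d \<le> c * n"
    proof -
      have "2 * d \<le> 1 * n" using False by simp
      also have "\<dots> \<le> c * n" using c by (intro mult_le_mono1)
      finally show ?thesis .
    qed
    then show ?thesis using handshake unfolding c(1) by (simp add: algebra_simps)
  qed
  then show "int d \<le> int d * int (card V') - int (card E')"
    by (simp add: n_def flip: of_nat_mult)
qed

section \<open>Existence of independent frameworks by induction on the number of vertices\<close>

lemma neighbours_del_vertex: "w \<noteq> v \<Longrightarrow> neighbours (del_vertex E v) w = neighbours E w - {v}"
  by (auto simp: neighbours_def del_vertex_def)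

lemma neighbours_insert:
  "neighbours (insert {x, y} E) w = neighbours E w \<union> (if w = x then {y} else {}) \<union> (if w = y then {x} else {})"
  by (auto simp: neighbours_def doubleton_eq_iff)

text \<open>Given the degree bound, the condition on all \<open>X\<close> says that no component is
  regular of degree \<open>CARD('d) + 2\<close>. Unlike connectedness, it survives the deletion of a
  vertex, which the induction requires.\<close>

lemma independent_framework_exists:
  fixes V :: "'v set"
  assumes q: "1 < q" "q \<noteq> 2" and d: "CARD('d::finite) \<ge> 3"
    and "finite_simple_graph V E"
    and "\<And>v. v \<in> V \<Longrightarrow> card (neighbours E v) \<le> CARD('d) + 2"
    and "\<And>X. X \<subseteq> V \<Longrightarrow> X \<noteq> {} \<Longrightarrow> \<exists>x\<in>X. card (neighbours E x \<inter> X) \<le> CARD('d) + 1"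
  shows "\<exists>p :: 'v \<Rightarrow> real ^ 'd. independent_framework q V E p"
  using assms(4-)
proof (induction "card V" arbitrary: V E rule: less_induct)
  case less
  note graph = less.prems(1) and max_deg = less.prems(2) and low = less.prems(3)
  have simple: "simple_graph V E" and finV: "finite V" using graph by (auto simp: finite_simple_graph_def)
  show ?case
  proof (cases "V = {}")
    case True
    then have "E = {}" using simple by (auto simp: simple_graph_def)
    then show ?thesis
      by (intro exI[of _ "\<lambda>_. 0"]) (simp add: independent_framework_def rows_lin_independent_def)
  next
    case False
    then obtain v where v: "v \<in> V" "card (neighbours E v \<inter> V) \<le> CARD('d) + 1" using low by blast
    define W where "W = neighbours E v"
    have WV: "W \<subseteq> V - {v}" unfolding W_def using neighbours_subset[OF simple] .
    then have "neighbours E v \<inter> V = W" by (auto simp: W_def)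
    then have cardW: "card W \<le> CARD('d) + 1" using v by simp
    have finW: "finite W" and finN: "finite (neighbours E w)" for w
      using finite_neighbours[OF graph] by (auto simp: W_def)
    let ?V = "V - {v}" and ?E = "del_vertex E v"
    have graph': "finite_simple_graph ?V ?E" using finite_simple_graph_del_vertex[OF graph] .
    have smaller: "card ?V < card V" using v finV by (intro psubset_card_mono) auto
    have "\<exists>p :: 'v \<Rightarrow> real ^ 'd. independent_framework q ?V ?E p"
    proof (rule less.hyps[OF smaller graph'])
      fix u assume u: "u \<in> ?V"
      then have "card (neighbours ?E u) \<le> card (neighbours E u)"
        by (intro card_mono finN) (auto simp: neighbours_del_vertex)
      then show "card (neighbours ?E u) \<le> CARD('d) + 2" using max_deg[of u] u by simp
    next
      fix X assume X: "X \<subseteq> ?V" "X \<noteq> {}"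
      then obtain x where x: "x \<in> X" "card (neighbours E x \<inter> X) \<le> CARD('d) + 1" using low[of X] by blast
      have "neighbours ?E x \<inter> X = neighbours E x \<inter> X"
        using X x by (subst neighbours_del_vertex) auto
      then show "\<exists>x\<in>X. card (neighbours ?E x \<inter> X) \<le> CARD('d) + 1" using x by (intro bexI[of _ x]) simp_all
    qed
    then obtain p0 :: "'v \<Rightarrow> real ^ 'd" where p0: "independent_framework q ?V ?E p0" by blast
    let ?U = "{p :: 'v \<Rightarrow> real ^ 'd. independent_framework q ?V ?E p}"
    have U: "open ?U" "p0 \<in> ?U" using independent_framework_open[OF graph' q(1)] p0 by auto
    show ?thesis
    proof (cases "card W = CARD('d) + 1")
      case False
      then show ?thesis
        using independent_framework_extend_low_degree[OF graph v(1) q(1) _ p0] cardW by (simp add: W_def)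
    next
      case True
      have extend: ?thesis
        if "open U" "U \<noteq> {}" "U \<subseteq> ?U"
          "\<And>p. p \<in> U \<Longrightarrow> \<exists>z. (\<forall>e\<in>?E.
            (\<Sum>j\<in>?V \<times> UNIV. altered_rigidity_matrix q p e j * z j) = 0) \<and>
          (\<exists>a\<in>W. \<exists>b\<in>W. \<exists>k. z (a, k) \<noteq> z (b, k))" for U :: "('v \<Rightarrow> real ^ 'd) set"
        by (rule independent_framework_extend_by_flex[OF graph v(1) q _ _ that(1,2)])
          (use that d cardW in \<open>auto simp: W_def\<close>)
      \<comment> \<open>Such sets are unions of components of the graph without
        \<open>v\<close>.\<close>
      define closed where "closed A \<longleftrightarrow> (\<forall>a b. {a, b} \<in> ?E \<longrightarrow> a \<in> A \<longrightarrow> b \<in> A)" for A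
      \<comment> \<open>If no closed set separates two neighbours of \<open>v\<close>, every closed
        set that contains one of them contains all of \<open>W\<close>; this is what
        \<open>missing\<close> records for \<open>x\<close>.\<close>
      consider (separated) A x y where "closed A" "x \<in> W" "y \<in> W" "x \<in> A" "y \<notin> A"
        | (clique) "\<forall>x\<in>W. \<forall>y\<in>W. x \<noteq> y \<longrightarrow> {x, y} \<in> E"
        | (missing) x y where "x \<in> W" "y \<in> W" "x \<noteq> y" "{x, y} \<notin> E"
          "\<forall>A. closed A \<longrightarrow> x \<in> A \<longrightarrow> W \<subseteq> A"
        by blast
      then show ?thesis
      proof cases
        case separated
        show ?thesis
        proof (rule extend[OF U(1)])
          fix p :: "'v \<Rightarrow> real ^ 'd"
          have "(\<Sum>j\<in>?V \<times> UNIV. altered_rigidity_matrix q p e j * of_bool (fst j \<in> A)) = 0" if "e \<in> ?E" for e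
            using flex_of_closed_set[OF graph _ that, of A] separated(1) by (simp add: closed_def)
          then show "\<exists>z. (\<forall>e\<in>?E. (\<Sum>j\<in>?V \<times> UNIV. altered_rigidity_matrix q p e j * z j) = 0) \<and>
              (\<exists>a\<in>W. \<exists>b\<in>W. \<exists>k. z (a, k) \<noteq> z (b, k))"
            using separated(2-5) by (intro exI[of _ "\<lambda>j. of_bool (fst j \<in> A)"] conjI ballI bexI[of _ x] bexI[of _ y]) auto
        qed (use U in auto)
      next
        case clique
        have "card (neighbours E w) \<le> CARD('d) + 2" if "w \<in> W" for w
          using max_deg that WV by auto
        then obtain U' where U': "U' \<subseteq> ?U" "open U'" "U' \<noteq> {}"
          and flex: "\<forall>p\<in>U'. \<exists>z. (\<forall>e\<in>?E.
              (\<Sum>j\<in>?V \<times> UNIV. altered_rigidity_matrix q p e j * z j) = 0) \<and>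
            (\<exists>a\<in>W. \<exists>b\<in>W. \<exists>k. z (a, k) \<noteq> z (b, k))"
          using flex_of_clique[OF graph q(1) d True[unfolded W_def] _ _ U] clique unfolding W_def by blast
        show ?thesis by (rule extend[OF U'(2,3,1)]) (use flex in blast)
      next
        case missing
        let ?E' = "insert {x, y} ?E"
        have xy: "x \<in> ?V" "y \<in> ?V" using missing WV by auto
        have graph'': "finite_simple_graph ?V ?E'"
          using graph' xy missing(3) by (auto simp: finite_simple_graph_def simple_graph_def)
        have nb: "neighbours ?E' u = (neighbours E u - {v}) \<union> (if u = x then {y} else {}) \<union> (if u = y then {x} else {})"
          if "u \<in> ?V" for u
          using that by (simp add: neighbours_insert neighbours_del_vertex)
        have v_nb: "v \<in> neighbours E u" if "u \<in> W" for u
          using that by (simp add: W_def neighbours_def insert_commute)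
        \<comment> \<open>The new edge costs \<open>x\<close> and \<open>y\<close> one neighbour
          each, but both have lost \<open>v\<close>.\<close>
        have deg': "card (neighbours ?E' u) \<le> card (neighbours E u)" if u: "u \<in> ?V" for u
        proof (cases "u = x \<or> u = y")
          case True
          then have "v \<in> neighbours E u" using missing v_nb by auto
          then have "card (neighbours E u) = Suc (card (neighbours E u - {v}))"
            using finN by (metis card.remove)
          moreover obtain t where "neighbours ?E' u = insert t (neighbours E u - {v})"
            using nb[OF u] True missing(3) by auto
          moreover have "card (insert t S) \<le> Suc (card S)" if "finite S" for t and S :: "'v set"
            using that by (simp add: card_insert_if)
          ultimately show ?thesis using finN by simp
        next
          case False
          then show ?thesis using nb[OF u] by (auto intro: card_mono finN)
        qed
        have "\<exists>p :: 'v \<Rightarrow> real ^ 'd. independent_framework q ?V ?E' p"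
        proof (rule less.hyps[OF smaller graph''])
          fix u assume "u \<in> ?V"
          then show "card (neighbours ?E' u) \<le> CARD('d) + 2" using deg'[of u] max_deg[of u] by simp
        next
          fix X assume X: "X \<subseteq> ?V" "X \<noteq> {}"
          show "\<exists>x\<in>X. card (neighbours ?E' x \<inter> X) \<le> CARD('d) + 1"
          proof (rule ccontr)
            assume "\<not> ?thesis"
            then have full: "card (neighbours ?E' u \<inter> X) \<ge> CARD('d) + 2" if "u \<in> X" for u
              using that by fastforce
            have finN': "finite (neighbours ?E' u)" for u using finite_neighbours[OF graph''] .
            have inside: "neighbours ?E' u \<subseteq> X" if "u \<in> X" for u
            proof -
              have "card (neighbours ?E' u) \<le> CARD('d) + 2"
                using deg'[of u] max_deg[of u] subsetD[OF X(1) that] by simp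
              then have "neighbours ?E' u \<inter> X = neighbours ?E' u"
                using full[OF that] finN' by (intro card_subset_eq) (auto intro: le_antisym card_mono order.trans)
              then show ?thesis by blast
            qed
            \<comment> \<open>Otherwise the new edge does not lie inside \<open>X\<close>, and
              \<open>low\<close> applies to \<open>X\<close> in the original graph.\<close>
            have "x \<in> X \<and> y \<in> X"
            proof (rule ccontr)
              assume "\<not> ?thesis"
              then have "neighbours ?E' u \<inter> X = neighbours E u \<inter> X" if "u \<in> X" for u
                using that subsetD[OF X(1) that] X(1) unfolding nb[OF subsetD[OF X(1) that]] by auto
              then show False using low[of X] X full by fastforce
            qed
            have "closed X"
              unfolding closed_def
            proof (intro allI impI)
              fix a b assume "{a, b} \<in> ?E" "a \<in> X"
              then have "b \<in> neighbours ?E' a" by (simp add: neighbours_def)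
              then show "b \<in> X" using inside \<open>a \<in> X\<close> by blast
            qed
            then have "W \<subseteq> X" using missing(5) \<open>x \<in> X \<and> y \<in> X\<close> by blast
            \<comment> \<open>A third neighbour \<open>w\<close> of \<open>v\<close> exists; it has
              lost \<open>v\<close> and gained nothing, so its degree is too small for
              \<open>full\<close>.\<close>
            have "card (W - {x, y}) \<ge> 1"
              using True d missing finW by (simp add: card_Diff_subset)
            then obtain w where w: "w \<in> W" "w \<noteq> x" "w \<noteq> y"
              by (cases "W - {x, y} = {}") auto
            then have "w \<in> ?V" using WV by auto
            have "neighbours ?E' w \<inter> X \<subseteq> neighbours E w - {v}" using nb[OF \<open>w \<in> ?V\<close>] w by auto
            then have "card (neighbours ?E' w \<inter> X) \<le> card (neighbours E w) - 1"
              using card_mono[of "neighbours E w - {v}"] finN v_nb[OF w(1)] by (metis card_Diff_singleton finite_Diff)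
            then show False using full[of w] \<open>W \<subseteq> X\<close> w max_deg[of w] \<open>w \<in> ?V\<close> by fastforce
          qed
        qed
        then obtain p1 :: "'v \<Rightarrow> real ^ 'd" where p1: "independent_framework q ?V ?E' p1" by blast
        let ?U' = "{p :: 'v \<Rightarrow> real ^ 'd. independent_framework q ?V ?E' p}"
        show ?thesis
        proof (rule extend[of ?U'])
          show "open ?U'" using independent_framework_open[OF graph'' q(1)] .
          show "?U' \<noteq> {}" using p1 by auto
          show "?U' \<subseteq> ?U"
            using independent_framework_subset finite_simple_graph_edges[OF graph''] by blast
          fix p assume "p \<in> ?U'"
          moreover have "{x, y} \<notin> ?E" using missing(4) by (simp add: del_vertex_def)
          ultimately show "\<exists>z. (\<forall>e\<in>?E. (\<Sum>j\<in>?V \<times> UNIV. altered_rigidity_matrix q p e j * z j) = 0) \<and>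
              (\<exists>a\<in>W. \<exists>b\<in>W. \<exists>k. z (a, k) \<noteq> z (b, k))"
            using flex_of_missing_edge[OF graph' xy missing(3), of q p] missing(1,2) by blast
        qed
      qed
    qed
  qed
qed

theorem theorem5p1:
  fixes q :: real and V :: "'v set" and E :: "'v set set"
  assumes "1 < q" and "q \<noteq> 2"
    and "CARD('d::finite) \<ge> 3"
    and "finite_simple_graph V E"
    and "connected_graph V E"
    and "min_degree V E \<le> CARD('d) + 1"
    and "max_degree V E \<le> CARD('d) + 2"
  shows "independent_graph TYPE('d) q V E \<longleftrightarrow> dd_sparse CARD('d) V E"
proof -
  have simple: "simple_graph V E" and fin: "finite V" and "V \<noteq> {}"
    using assms(4,5) by (auto simp: finite_simple_graph_def connected_graph_def)
  have deg: "vertex_degree E v \<le> CARD('d) + 2" if "v \<in> V" for v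
  proof -
    have "vertex_degree E v \<le> max_degree V E"
      unfolding max_degree_def using fin that by (intro Max_ge) auto
    then show ?thesis using assms(7) by simp
  qed
  have "min_degree V E \<in> vertex_degree E ` V"
    unfolding min_degree_def using fin \<open>V \<noteq> {}\<close> by (intro Min_in) auto
  then obtain v0 where v0: "v0 \<in> V" "vertex_degree E v0 \<le> CARD('d) + 1"
    using assms(6) by auto
  have "\<exists>p :: 'v \<Rightarrow> real ^ 'd. independent_framework q V E p"
  proof (rule independent_framework_exists[OF assms(1-4)])
    fix v assume "v \<in> V"
    then show "card (neighbours E v) \<le> CARD('d) + 2"
      using deg by (simp add: vertex_degree_eq_card_neighbours[OF simple])
  next
    fix X assume X: "X \<subseteq> V" "X \<noteq> {}"
    show "\<exists>x\<in>X. card (neighbours E x \<inter> X) \<le> CARD('d) + 1"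
    \<comment> \<open>A set \<open>X\<close> that violates the bound contains every neighbour of its
      members, hence by connectedness also \<open>v0\<close>, whose degree is too small.\<close>
    proof (rule ccontr)
      assume "\<not> ?thesis"
      then have full: "card (neighbours E u \<inter> X) \<ge> CARD('d) + 2" if "u \<in> X" for u
        using that by fastforce
      have closed: "neighbours E u \<subseteq> X" if "u \<in> X" for u
      proof -
        have "card (neighbours E u) \<le> CARD('d) + 2"
          using deg[of u] X that by (auto simp: vertex_degree_eq_card_neighbours[OF simple])
        then have "neighbours E u \<inter> X = neighbours E u"
          using full[OF that] finite_neighbours[OF assms(4), of u]
          by (intro card_subset_eq) (auto intro: le_antisym card_mono order.trans)
        then show ?thesis by blast
      qed
      obtain x where "x \<in> X" using X by blast
      have "(x, v0) \<in> {(x, y). {x, y} \<in> E}\<^sup>*"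
        using assms(5) X \<open>x \<in> X\<close> v0 by (auto simp: connected_graph_def)
      then have "v0 \<in> X"
        by (induction rule: rtrancl_induct) (use \<open>x \<in> X\<close> closed in \<open>auto simp: neighbours_def\<close>)
      then have "neighbours E v0 \<inter> X = neighbours E v0" using closed by blast
      then show False
        using full[OF \<open>v0 \<in> X\<close>] v0 by (simp add: vertex_degree_eq_card_neighbours[OF simple])
    qed
  qed
  then have "independent_graph TYPE('d) q V E"
    unfolding independent_graph_def using independent_framework_imp_placement[OF assms(4)] by blast
  moreover have "dd_sparse CARD('d) V E"
    using dd_sparse_of_max_degree[OF assms(4,3) deg] .
  ultimately show ?thesis by simp
qed

end
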